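(* Let $n\ge1$, $k\ge0$, let $(\mathbb{A},\cdot)$ be a non-associative monoid and let $f_1,\dots,f_k:\mathbb{A}\to\mathbb{A}$ be morphisms. Let $Q_{n,k}=\Delta_{n-1}\times[0,1]^k\subset\mathbb{R}^n\times\mathbb{R}^k$ and let $(c,r)\in\mathbb{R}^{n+k}$ be an objective function with $c_1<c_2<\cdots<c_n$ and $r_i>0$ for $i=1,\dots,k$. Then the vertices of the max-slope pivot rule polytope $\Pi(Q_{n,k},(c,r))$ are in bijection with the possible ways of evaluating $$(f_{\sigma(1)}\circ f_{\sigma(2)}\circ\cdots\circ f_{\sigma(k)})(a_1\cdot a_2\cdots a_n),$$ where $a_1,\dots,a_n\in\mathbb{A}$ and $\sigma\in\mathfrak{S}_k$ ranges over all permutations of $\{1,\dots,k\}$.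
   Context: $\Delta_{n-1}=\mathrm{conv}(e_1,\dots,e_n)\subset\mathbb{R}^n$ is the standard simplex. Let $P\subset\mathbb{R}^d$ be a convex polytope with vertex set $V(P)$ and edge set $E(P)$. A vector $c\in\mathbb{R}^d$ is edge-generic for $P$ if $\langle c,u\rangle\ne\langle c,v\rangle$ for all edges $uv\in E(P)$. Then $c$ has a unique maximizer $v_{\mathrm{opt}}\in V(P)$ over $P$. A $c$-arborescence of $(P,c)$ is a map $\mathcal{A}:V(P)\setminus\{v_{\mathrm{opt}}\}\to V(P)$ such that for every $v\neq v_{\mathrm{opt}}$, $\mathcal{A}(v)$ is adjacent to $v$ and $\langle c,\mathcal{A}(v)\rangle>\langle c,v\rangle$. Put $\psi(\mathcal{A})=\sum_{v\ne v_{\mathrm{opt}}}\frac{\mathcal{A}(v)-v}{\langle c,\mathcal{A}(v)-v\rangle}$. The max-slope pivot rule polytope of $(P,c)$ is $\Pi(P,c)=\mathrm{conv}\{\psi(\mathcal{A}):\mathcal{A}\text{ a }c\text{-arborescence of }(P,c)\}$. Ways of evaluating are counted formally (not by the resulting value). For fixed $\sigma$, the morphisms are applied in the order prescribed by the composition, and the product $a_1\cdots a_n$ contains $n-1$ multiplications, labelled $1,\dots,n-1$ from left to right; a multiplication $x\cdot y$ may be carried out before a morphism $f$ is applied to it, or after, using $f(x\cdot y)=f(x)\cdot f(y)$. The order in which multiplications are carried out is recorded by a partial order $\preceq_T$ on $[n-1]=\{1,\dots,n-1\}$ given by a binary search tree $T$: a rooted binary tree with nodes labelled bijectively by $[n-1]$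 such that for each node $j$ all labels in its left subtree are smaller than $j$ and all labels in its right subtree are larger than $j$; $i\preceq_T j$ iff $i$ lies in the subtree rooted at $j$ (the root is the last multiplication). For each multiplication $j$ let $\phi(j)\in\{0,1,\dots,k\}$ be the number of morphisms applied before multiplication $j$ takes place; $\phi$ is order-preserving ($i\preceq_T j$ implies $\phi(i)\le\phi(j)$). Thus an evaluation is the same as a triple $(\sigma,T,\phi)$ consisting of a permutation $\sigma\in\mathfrak{S}_k$, a binary search tree $T$ on $[n-1]$, and an order-preserving map $\phi:([n-1],\preceq_T)\to\{0,1,\dots,k\}$. *)

theory Defs
  imports
    "HOL-Analysis.Analysis"
    "HOL-Library.Tree"
    "HOL-Combinatorics.Permutations"
    "HOL-Algebra.Group"
begin

definition vertices :: "'a::euclidean_space set \<Rightarrow> 'a set" where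
  "vertices P = {v. v extreme_point_of P}"

definition adjacent :: "'a::euclidean_space set \<Rightarrow> 'a \<Rightarrow> 'a \<Rightarrow> bool" where
  "adjacent P u v \<longleftrightarrow> closed_segment u v edge_of P"

(* Meaningful when the maximizer is unique, in particular for edge-generic c
   on a nonempty polytope P. *)
definition v_opt :: "'a::euclidean_space set \<Rightarrow> 'a \<Rightarrow> 'a" where
  "v_opt P c = (THE v. v \<in> vertices P \<and> (\<forall>x\<in>P. c \<bullet> x \<le> c \<bullet> v))"

definition arborescences :: "'a::euclidean_space set \<Rightarrow> 'a \<Rightarrow> ('a \<Rightarrow> 'a) set" where
  "arborescences P c =
     {A \<in> (vertices P - {v_opt P c}) \<rightarrow>\<^sub>E vertices P.
        \<forall>v \<in> vertices P - {v_opt P c}. adjacent P v (A v) \<and> c \<bullet> A v > c \<bullet> v}"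

definition psi :: "'a::euclidean_space set \<Rightarrow> 'a \<Rightarrow> ('a \<Rightarrow> 'a) \<Rightarrow> 'a" where
  "psi P c A = (\<Sum>v \<in> vertices P - {v_opt P c}. (1 / (c \<bullet> (A v - v))) *\<^sub>R (A v - v))"

definition max_slope_polytope :: "'a::euclidean_space set \<Rightarrow> 'a \<Rightarrow> 'a set" where
  "max_slope_polytope P c = convex hull (psi P c ` arborescences P c)"

(* The space R^n x R^k is an arbitrary Euclidean space whose standard basis is
   enumerated as b 1, ..., b (n + k): the first n basis vectors span the factor R^n,
   the remaining k span R^k.  (A product of two Euclidean-space types would exclude
   k = 0.) *)

definition simplex_times_cube :: "(nat \<Rightarrow> 'a::euclidean_space) \<Rightarrow> nat \<Rightarrow> nat \<Rightarrow> 'a set" where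
  "simplex_times_cube b n k =
     {x + (\<Sum>j\<in>{1..k}. t j *\<^sub>R b (n + j)) | x t.
        x \<in> convex hull (b ` {1..n}) \<and> (\<forall>j\<in>{1..k}. t j \<in> {0..1})}"

definition objective ::
  "(nat \<Rightarrow> 'a::euclidean_space) \<Rightarrow> nat \<Rightarrow> nat \<Rightarrow> (nat \<Rightarrow> real) \<Rightarrow> (nat \<Rightarrow> real) \<Rightarrow> 'a" where
  "objective b n k c r =
     (\<Sum>i\<in>{1..n}. c i *\<^sub>R b i) + (\<Sum>j\<in>{1..k}. r j *\<^sub>R b (n + j))"

definition nonassoc_monoid :: "'a monoid \<Rightarrow> bool" where
  "nonassoc_monoid M \<longleftrightarrow>
     (\<forall>x \<in> carrier M. \<forall>y \<in> carrier M. x \<otimes>\<^bsub>M\<^esub> y \<in> carrier M) \<and>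
     \<one>\<^bsub>M\<^esub> \<in> carrier M \<and>
     (\<forall>x \<in> carrier M. \<one>\<^bsub>M\<^esub> \<otimes>\<^bsub>M\<^esub> x = x \<and> x \<otimes>\<^bsub>M\<^esub> \<one>\<^bsub>M\<^esub> = x)"

definition monoid_morphism :: "'a monoid \<Rightarrow> ('a \<Rightarrow> 'a) \<Rightarrow> bool" where
  "monoid_morphism M f \<longleftrightarrow> f \<in> hom M M \<and> f \<one>\<^bsub>M\<^esub> = \<one>\<^bsub>M\<^esub>"

definition search_trees :: "nat \<Rightarrow> nat tree set" where
  "search_trees n = {T. bst T \<and> set_tree T = {1..n - 1}}"

definition tree_le :: "nat tree \<Rightarrow> nat \<Rightarrow> nat \<Rightarrow> bool" where
  "tree_le T i j \<longleftrightarrow> (\<exists>l r. Node l j r \<in> subtrees T \<and> i \<in> set_tree (Node l j r))"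

(* Evaluations of (f (s 1) o ... o f (s k)) (a 1 * ... * a n), counted formally: they
   depend on n and k only, not on the monoid, the f i or the a i.  The tree T records
   the order of the multiplications 1, ..., n - 1, and phi j is the number of morphisms
   applied before multiplication j.  Both s (identity outside {1..k}) and phi (undefined
   outside {1..n - 1}) are determined by their values on their proper domains. *)
definition evaluations :: "nat \<Rightarrow> nat \<Rightarrow> ((nat \<Rightarrow> nat) \<times> nat tree \<times> (nat \<Rightarrow> nat)) set" where
  "evaluations n k =
     {(s, T, phi).
        s permutes {1..k} \<and> T \<in> search_trees n \<and>
        phi \<in> {1..n - 1} \<rightarrow>\<^sub>E {0..k} \<and>
        monotone_on {1..n - 1} (tree_le T) (\<le>) phi}"

end

theory Submission
  imports Defs
begin

text \<open>
  The polytope is the Minkowski sum, over the vertices \<open>v\<close> other than the optimum, of the polytopes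
  spanned by the normalised improving edge directions at \<open>v\<close>, and distinct improving edges at \<open>v\<close> have
  distinct normalised directions. Hence its vertices are the points \<open>psi A\<close> for which some functional
  \<open>w\<close> has \<open>A v\<close> as the unique improving neighbour of largest \<open>w\<close>-slope at every \<open>v\<close>, and distinct
  such \<open>A\<close> give distinct vertices.

  A vertex of simplex times cube is a pair \<open>(i, S)\<close>; its improving neighbours are \<open>(j, S)\<close> with \<open>j > i\<close>
  and \<open>(i, insert l S)\<close> with \<open>l \<notin> S\<close>. The slope of the latter depends only on \<open>l\<close>, that of the
  former only on \<open>i\<close> and \<open>j\<close>. So \<open>w\<close> enters through the decreasing order \<open>s\<close> of the cube slopes, the
  steepest target \<open>A i\<close> of every \<open>i < n\<close> with its slope \<open>M i\<close>, and the number \<open>phi i\<close> of cube slopes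
  exceeding \<open>M i\<close>. The map \<open>A\<close> follows the upper convex hulls of the points \<open>(c i, w i)\<close>; convexity
  makes it noncrossing, so it encodes a binary search tree, along which \<open>M\<close> decreases and \<open>phi\<close>
  therefore increases. Conversely slopes decreasing along the tree can be prescribed freely.
\<close>

section \<open>Vertices of max-slope pivot rule polytopes\<close>

lemma strict_max_extreme_point:
  fixes w :: "'a::euclidean_space"
  assumes "finite X" "x \<in> X" and less: "\<And>y. y \<in> X - {x} \<Longrightarrow> w \<bullet> y < w \<bullet> x"
  shows "x extreme_point_of (convex hull X)"
proof -
  have "convex hull (X - {x}) \<subseteq> {y. w \<bullet> y < w \<bullet> x}"
    using less by (intro hull_minimal) (auto simp: convex_halfspace_lt)
  then have "x \<notin> convex hull (X - {x})" by auto
  moreover have "insert x (X - {x}) = X" using \<open>x \<in> X\<close> by auto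
  ultimately show ?thesis
    using extreme_point_of_convex_hull_insert[of "X - {x}" x] assms(1) by auto
qed

text \<open>Deleting an extreme point leaves the hull convex, so \<open>x\<close> lies outside the
  hull of the other points. That hull is compact and can be separated from \<open>x\<close>; the
  sign is flipped because the separating \<open>a\<close> is small at \<open>x\<close>.\<close>

lemma extreme_point_strict_max:
  fixes x :: "'a::euclidean_space"
  assumes "finite X" "x extreme_point_of (convex hull X)"
  obtains w where "\<And>y. y \<in> X - {x} \<Longrightarrow> w \<bullet> y < w \<bullet> x"
proof -
  have "convex (convex hull X - {x})"
    using assms(2) by (simp add: extreme_point_of_stillconvex)
  then have "convex hull (X - {x}) \<subseteq> convex hull X - {x}"
    by (intro hull_minimal) (auto intro: hull_inc)
  then have "x \<notin> convex hull (X - {x})" by auto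
  then obtain a \<beta> where "a \<bullet> x < \<beta>" "\<forall>y\<in>convex hull (X - {x}). a \<bullet> y > \<beta>"
    using separating_hyperplane_closed_point[of "convex hull (X - {x})" x] assms(1)
    by (auto simp: finite_imp_compact_convex_hull compact_imp_closed)
  then have "(- a) \<bullet> y < (- a) \<bullet> x" if "y \<in> X - {x}" for y
    using hull_inc[OF that, of convex] by force
  then show ?thesis by (rule that)
qed

text \<open>Of two extreme points on one ray from \<open>v\<close>, the nearer would lie inside the
  segment from \<open>v\<close> to the farther. Hence different neighbours of a vertex have
  different normalised edge directions.\<close>

lemma extreme_points_ray:
  fixes u v x :: "'a::euclidean_space"
  assumes "u extreme_point_of P" "x extreme_point_of P" "v \<in> P" "u \<noteq> v" "x \<noteq> v"
    and "s > 0" "t > 0" "s *\<^sub>R (u - v) = t *\<^sub>R (x - v)"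
  shows "u = x"
proof -
  \<comment> \<open>Since \<open>u - v\<close> is \<open>t / s\<close> times \<open>x - v\<close>,
    the assumption \<open>t \<le> s\<close> makes \<open>u\<close> the nearer point; the other case
    is symmetric.\<close>
  have aux: "u = x" if "u extreme_point_of P" "x extreme_point_of P" "u \<noteq> v"
      "s *\<^sub>R (u - v) = t *\<^sub>R (x - v)" "0 < t" "t \<le> s" for u x and s t :: real
  proof (rule ccontr)
    assume "u \<noteq> x"
    have "u - v = (1 / s) *\<^sub>R (s *\<^sub>R (u - v))" using \<open>0 < t\<close> \<open>t \<le> s\<close> by simp
    also have "\<dots> = (t / s) *\<^sub>R (x - v)" unfolding that(4) by (simp only: scaleR_scaleR) simp
    finally have eq: "u = v + (t / s) *\<^sub>R (x - v)" by (simp add: algebra_simps)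
    then have "t / s \<noteq> 1" using \<open>u \<noteq> x\<close> by auto
    then have ts: "0 < t / s" "t / s < 1" using that by auto
    have "v \<noteq> x" using eq that(3) by auto
    then have "u \<in> open_segment v x"
      using ts eq by (auto simp: in_segment algebra_simps intro!: exI[of _ "t / s"])
    moreover have "x \<in> P" using that by (simp add: extreme_point_of_def)
    ultimately show False using that(1) \<open>v \<in> P\<close> by (auto simp: extreme_point_of_def)
  qed
  show ?thesis
  proof (cases "t \<le> s")
    case True then show ?thesis using aux[of u x s t] assms by auto
  next
    case False then show ?thesis using aux[of x u t s] assms by auto
  qed
qed

section \<open>Coherent arborescences and vertices of the pivot rule polytope\<close>

text \<open>The arborescence followed by the max-slope rule with auxiliary functional
  \<open>w\<close>. Strictness excludes ties for the steepest improving edge.\<close>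

definition coherent :: "'a::euclidean_space set \<Rightarrow> 'a \<Rightarrow> 'a \<Rightarrow> ('a \<Rightarrow> 'a) \<Rightarrow> bool" where
  "coherent P c w A \<longleftrightarrow> A \<in> arborescences P c \<and>
     (\<forall>v \<in> vertices P - {v_opt P c}. \<forall>u \<in> vertices P.
        adjacent P v u \<longrightarrow> c \<bullet> v < c \<bullet> u \<longrightarrow> u \<noteq> A v \<longrightarrow>
        w \<bullet> (u - v) / (c \<bullet> (u - v)) < w \<bullet> (A v - v) / (c \<bullet> (A v - v)))"

lemma inner_psi:
  "w \<bullet> psi P c A = (\<Sum>v \<in> vertices P - {v_opt P c}. w \<bullet> (A v - v) / (c \<bullet> (A v - v)))"
  by (simp add: psi_def inner_sum_right)

lemma arborescences_eqI:
  assumes "A \<in> arborescences P c" "B \<in> arborescences P c"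
    and "\<And>v. v \<in> vertices P - {v_opt P c} \<Longrightarrow> A v = B v"
  shows "A = B"
  using assms unfolding arborescences_def by (auto intro: PiE_ext)

lemma finite_arborescences:
  assumes "finite (vertices P)" shows "finite (arborescences P c)"
  by (rule finite_subset[OF _ finite_PiE[of "vertices P - {v_opt P c}" "\<lambda>_. vertices P"]])
    (auto simp: arborescences_def assms)

text \<open>By \<open>inner_psi\<close>, the value of \<open>w\<close> is a sum of one slope per
  vertex. \<open>A\<close> is at least as good in every summand and strictly better wherever
  \<open>B\<close> differs.\<close>

lemma coherent_strict_max:
  assumes "finite (vertices P)" and coh: "coherent P c w A"
    and B: "B \<in> arborescences P c" "B \<noteq> A"
  shows "w \<bullet> psi P c B < w \<bullet> psi P c A"
proof -
  let ?V = "vertices P - {v_opt P c}"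
  have A: "A \<in> arborescences P c" using coh by (simp add: coherent_def)
  have less: "w \<bullet> (B v - v) / (c \<bullet> (B v - v)) < w \<bullet> (A v - v) / (c \<bullet> (A v - v))"
    if "v \<in> ?V" "B v \<noteq> A v" for v
    using coh B(1) that unfolding coherent_def arborescences_def by blast
  obtain v where "v \<in> ?V" "B v \<noteq> A v" using arborescences_eqI[OF B(1) A] B(2) by blast
  moreover have "w \<bullet> (B v - v) / (c \<bullet> (B v - v)) \<le> w \<bullet> (A v - v) / (c \<bullet> (A v - v))" if "v \<in> ?V" for v
    using less[OF that] by (cases "B v = A v") auto
  ultimately show ?thesis unfolding inner_psi
    using less assms(1) by (intro sum_strict_mono_ex1) blast+
qed

lemma coherent_unique:
  assumes "finite (vertices P)" "coherent P c w A" "coherent P c w B"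
  shows "A = B"
  using coherent_strict_max[OF assms(1,2), of B] coherent_strict_max[OF assms(1,3), of A] assms
  by (force simp: coherent_def)

text \<open>Rerouting \<open>A\<close> at a single vertex \<open>v\<close> to another improving
  neighbour gives an arborescence whose \<open>psi\<close> differs only in the summand at
  \<open>v\<close>, so global optimality yields optimality of each slope.\<close>

lemma strict_max_coherent:
  assumes fin: "finite (vertices P)" and A: "A \<in> arborescences P c"
    and max: "\<And>B. B \<in> arborescences P c \<Longrightarrow> psi P c B \<noteq> psi P c A \<Longrightarrow>
      w \<bullet> psi P c B < w \<bullet> psi P c A"
  shows "coherent P c w A"
  unfolding coherent_def
proof (intro conjI ballI impI)
  let ?V = "vertices P - {v_opt P c}"
  fix v u assume v: "v \<in> ?V" and u: "u \<in> vertices P" "adjacent P v u" "c \<bullet> v < c \<bullet> u" "u \<noteq> A v"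
  let ?d = "\<lambda>u. (1 / (c \<bullet> (u - v))) *\<^sub>R (u - v)"
  let ?B = "A(v := u)"
  have "?B \<in> ?V \<rightarrow>\<^sub>E vertices P"
    using A u(1) PiE_fun_upd[of u "\<lambda>_. vertices P" v A ?V] v
    by (simp add: arborescences_def insert_absorb)
  then have B: "?B \<in> arborescences P c" using A v u by (simp add: arborescences_def)
  have Av: "A v \<in> vertices P" "c \<bullet> v < c \<bullet> A v" using A v by (auto simp: arborescences_def)
  define rest where "rest = (\<Sum>y\<in>?V - {v}. (1 / (c \<bullet> (A y - y))) *\<^sub>R (A y - y))"
  have upd: "psi P c (A(v := x)) = ?d x + rest" for x
    unfolding psi_def rest_def using v fin by (subst sum.remove[of _ v]) (auto intro!: sum.cong)
  have psi_A: "psi P c A = ?d (A v) + rest" using upd[of "A v"] by simp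
  \<comment> \<open>\<open>max\<close> compares only arborescences with different
    \<open>psi\<close>, so the two normalised directions must be shown to differ.\<close>
  have "?d u \<noteq> ?d (A v)"
  proof
    assume "?d u = ?d (A v)"
    moreover have "u \<noteq> v" "A v \<noteq> v" using u Av by auto
    ultimately have "u = A v"
      using extreme_points_ray[of u P "A v" v "1 / (c \<bullet> (u - v))" "1 / (c \<bullet> (A v - v))"] v u Av
      by (auto simp: vertices_def extreme_point_of_def inner_diff_right)
    then show False using u by simp
  qed
  then have "psi P c ?B \<noteq> psi P c A" unfolding upd psi_A by simp
  from max[OF B this] have "w \<bullet> ?d u < w \<bullet> ?d (A v)"
    unfolding upd psi_A by (simp only: inner_add_right add_less_cancel_right)
  then show "w \<bullet> (u - v) / (c \<bullet> (u - v)) < w \<bullet> (A v - v) / (c \<bullet> (A v - v))"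
    by simp
qed (fact A)

lemma bij_betw_psi:
  assumes fin: "finite (vertices P)"
  shows "bij_betw (psi P c) {A. \<exists>w. coherent P c w A} (vertices (max_slope_polytope P c))"
  unfolding bij_betw_def
proof
  show "inj_on (psi P c) {A. \<exists>w. coherent P c w A}"
  proof (rule inj_onI, rule ccontr)
    fix A B assume "A \<in> {A. \<exists>w. coherent P c w A}" "B \<in> {A. \<exists>w. coherent P c w A}"
      and eq: "psi P c A = psi P c B" "A \<noteq> B"
    then obtain w where "coherent P c w A" and "B \<in> arborescences P c"
      unfolding coherent_def by auto
    from coherent_strict_max[OF fin this] show False using eq by simp
  qed
  let ?X = "psi P c ` arborescences P c"
  have finX: "finite ?X" using finite_arborescences[OF fin] by simp
  show "psi P c ` {A. \<exists>w. coherent P c w A} = vertices (max_slope_polytope P c)"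
  proof (intro equalityI subsetI)
    fix x assume "x \<in> psi P c ` {A. \<exists>w. coherent P c w A}"
    then obtain A w where x: "x = psi P c A" and coh: "coherent P c w A" by blast
    have "w \<bullet> y < w \<bullet> x" if "y \<in> ?X - {x}" for y
      using coherent_strict_max[OF fin coh] that x by auto
    then show "x \<in> vertices (max_slope_polytope P c)"
      using strict_max_extreme_point[OF finX, of x w] coh x
      by (auto simp: coherent_def vertices_def max_slope_polytope_def)
  next
    fix x assume "x \<in> vertices (max_slope_polytope P c)"
    then have ext: "x extreme_point_of (convex hull ?X)"
      by (simp add: vertices_def max_slope_polytope_def)
    then obtain w where w: "\<And>y. y \<in> ?X - {x} \<Longrightarrow> w \<bullet> y < w \<bullet> x"
      using extreme_point_strict_max[OF finX] by blast
    obtain A where A: "A \<in> arborescences P c" "x = psi P c A"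
      using ext extreme_point_of_convex_hull by blast
    then have "coherent P c w A" using w by (intro strict_max_coherent[OF fin]) auto
    then show "x \<in> psi P c ` {A. \<exists>w. coherent P c w A}" using A by blast
  qed
qed

section \<open>Binary search trees as noncrossing maps\<close>

text \<open>If \<open>T\<close> has the label set \<open>{a..<d}\<close>, then \<open>succ_above T d j\<close> is the least label
  (or \<open>d\<close>) above the subtree rooted at \<open>j\<close>.\<close>

fun succ_above :: "nat tree \<Rightarrow> nat \<Rightarrow> nat \<Rightarrow> nat" where
  "succ_above Leaf d j = d"
| "succ_above (Node l x r) d j =
     (if j < x then succ_above l x j else if j = x then d else succ_above r d j)"

text \<open>The search-tree order splits the interval at the root, which lets inductions over
  \<open>T\<close> generalise \<open>a\<close> and \<open>d\<close>.\<close>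

lemma bst_interval_Node:
  assumes "bst (Node l x r)" "set_tree (Node l x r) = {a..<d}"
  shows "bst l" "bst r" "set_tree l = {a..<x}" "set_tree r = {Suc x..<d}" "a \<le> x" "x < d"
proof -
  have l: "\<And>i. i \<in> set_tree l \<Longrightarrow> i < x" and r: "\<And>i. i \<in> set_tree r \<Longrightarrow> x < i"
    using assms(1) by auto
  have eq: "i \<in> set_tree l \<or> i = x \<or> i \<in> set_tree r \<longleftrightarrow> a \<le> i \<and> i < d" for i
    using assms(2) by (auto simp: set_eq_iff)
  show "bst l" "bst r" using assms(1) by auto
  show x: "a \<le> x" "x < d" using eq[of x] by auto
  show "set_tree l = {a..<x}"
  proof (intro equalityI subsetI)
    show "i \<in> {a..<x}" if "i \<in> set_tree l" for i using that eq[of i] l[of i] by auto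
    show "i \<in> set_tree l" if "i \<in> {a..<x}" for i using that eq[of i] r[of i] x by force
  qed
  show "set_tree r = {Suc x..<d}"
  proof (intro equalityI subsetI)
    show "i \<in> {Suc x..<d}" if "i \<in> set_tree r" for i using that eq[of i] r[of i] by auto
    show "i \<in> set_tree r" if "i \<in> {Suc x..<d}" for i using that eq[of i] l[of i] x by force
  qed
qed

lemma succ_above_bounds:
  assumes "bst T" "set_tree T = {a..<d}" "j \<in> {a..<d}"
  shows "j < succ_above T d j" "succ_above T d j \<le> d"
proof -
  have "j < succ_above T d j \<and> succ_above T d j \<le> d"
    using assms
  proof (induction T arbitrary: a d)
    case (Node l x r)
    note N = bst_interval_Node[OF Node.prems(1,2)]
    show ?case
      using Node.IH(1)[OF N(1,3)] Node.IH(2)[OF N(2,4)] Node.prems(3) N(5,6) by force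
  qed simp
  then show "j < succ_above T d j" "succ_above T d j \<le> d" by auto
qed

text \<open>Draw an arc from each label to its value. Arcs starting left of the root
  \<open>x\<close> end at \<open>x\<close> or before, and the arc from \<open>x\<close> ends at the
  maximum \<open>d\<close>; induction handles the two sides.\<close>

lemma succ_above_noncrossing:
  assumes "bst T" "set_tree T = {a..<d}" "i \<in> {a..<d}" "i < p" "p < succ_above T d i"
  shows "succ_above T d p \<le> succ_above T d i"
  using assms
proof (induction T arbitrary: a d)
  case (Node l x r)
  note N = bst_interval_Node[OF Node.prems(1,2)]
  consider "i < x" | "i = x" | "x < i" by linarith
  then show ?case
  proof cases
    case 1
    then show ?thesis
      using Node.IH(1)[OF N(1,3)] Node.prems succ_above_bounds[OF N(1,3), of i] by auto
  next
    case 2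
    then show ?thesis
      using Node.prems succ_above_bounds[OF N(2,4), of p] by auto
  next
    case 3
    then show ?thesis
      using Node.IH(2)[OF N(2,4)] Node.prems by auto
  qed
qed simp

text \<open>The root is recognisable as the least label with value \<open>d\<close>, because values
  in the left subtree are at most the root.\<close>

lemma succ_above_inj:
  assumes "bst T" "bst U" "set_tree T = {a..<d}" "set_tree U = {a..<d}"
    and "\<And>j. j \<in> {a..<d} \<Longrightarrow> succ_above T d j = succ_above U d j"
  shows "T = U"
  using assms
proof (induction T arbitrary: U a d)
  case Leaf
  then show ?case by (cases U) auto
next
  case (Node l x r)
  note N = bst_interval_Node[OF Node.prems(1,3)]
  obtain l' y r' where U: "U = Node l' y r'" using Node.prems N by (cases U) auto
  note N' = bst_interval_Node[OF Node.prems(2)[unfolded U] Node.prems(4)[unfolded U]]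
  have "y = x"
  proof (rule linorder_cases[of x y])
    assume "x < y"
    then show ?thesis
      using Node.prems(5)[of x] succ_above_bounds[OF N'(1,3), of x] N N' U by auto
  next
    assume "y < x"
    then show ?thesis
      using Node.prems(5)[of y] succ_above_bounds[OF N(1,3), of y] N N' U by auto
  qed auto
  moreover have "l = l'"
  proof (rule Node.IH(1)[OF N(1) N'(1) N(3)])
    show "set_tree l' = {a..<x}" using N' \<open>y = x\<close> by simp
    fix j assume "j \<in> {a..<x}"
    then show "succ_above l x j = succ_above l' x j"
      using Node.prems(5)[of j] U \<open>y = x\<close> N by auto
  qed
  moreover have "r = r'"
  proof (rule Node.IH(2)[OF N(2) N'(2) N(4)])
    show "set_tree r' = {Suc x..<d}" using N' \<open>y = x\<close> by simp
    fix j assume "j \<in> {Suc x..<d}"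
    then show "succ_above r d j = succ_above r' d j"
      using Node.prems(5)[of j] U \<open>y = x\<close> N by auto
  qed
  ultimately show ?case using U by simp
qed

text \<open>Taking the least label with value \<open>d\<close> as root splits a noncrossing map into
  noncrossing maps on two shorter intervals.\<close>

lemma noncrossing_imp_bst:
  assumes "\<And>i. i \<in> {a..<d} \<Longrightarrow> i < A i \<and> A i \<le> d"
    and "\<And>i p. i \<in> {a..<d} \<Longrightarrow> i < p \<Longrightarrow> p < A i \<Longrightarrow> A p \<le> A i"
  shows "\<exists>T. bst T \<and> set_tree T = {a..<d} \<and> (\<forall>j\<in>{a..<d}. succ_above T d j = A j)"
  using assms
proof (induction "d - a" arbitrary: a d rule: less_induct)
  case less
  show ?case
  proof (cases "a < d")
    case False
    then show ?thesis by (intro exI[of _ Leaf]) auto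
  next
    case True
    define x where "x = (LEAST i. a \<le> i \<and> A i = d)"
    obtain e where e: "d = Suc e" "a \<le> e" using True by (cases d) auto
    \<comment> \<open>The last label has no possible target but \<open>d\<close>, so a root
      exists.\<close>
    then have "A e = d" using less.prems(1)[of e] by auto
    then have x: "a \<le> x \<and> A x = d" unfolding x_def using e LeastI[of "\<lambda>i. a \<le> i \<and> A i = d" e] by auto
    have "x \<le> e" unfolding x_def by (rule Least_le) (use e \<open>A e = d\<close> in auto)
    then have "x < d" using e by auto
    \<comment> \<open>An arc from \<open>i\<close> over \<open>x\<close> would by noncrossing reach
      \<open>A x = d\<close>, against the minimality of \<open>x\<close>. So \<open>x\<close> can
      serve as the right end of the left piece.\<close>
    have below: "A i \<le> x" if "a \<le> i" "i < x" for i
    proof (rule ccontr)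
      assume "\<not> A i \<le> x"
      then have "A x \<le> A i" using less.prems(2)[of i x] that \<open>x < d\<close> by auto
      then have "A i = d" using less.prems(1)[of i] that \<open>x < d\<close> x by auto
      then show False using not_less_Least[of i "\<lambda>i. a \<le> i \<and> A i = d"] that by (simp add: x_def)
    qed
    obtain l where l: "bst l" "set_tree l = {a..<x}" "\<And>j. j \<in> {a..<x} \<Longrightarrow> succ_above l x j = A j"
      using less.hyps[of x a] less.prems below \<open>x < d\<close> x by fastforce
    obtain r where r: "bst r" "set_tree r = {Suc x..<d}"
        "\<And>j. j \<in> {Suc x..<d} \<Longrightarrow> succ_above r d j = A j"
      using less.hyps[of d "Suc x"] less.prems \<open>x < d\<close> x by fastforce
    show ?thesis
      using l r x \<open>x < d\<close> by (intro exI[of _ "Node l x r"]) (auto simp: Suc_le_eq)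
  qed
qed

text \<open>The labels strictly under the arc of \<open>i\<close> form its right subtree; the end of
  the arc, if it is a label, is the nearest ancestor with \<open>i\<close> in its left subtree. For
  transitive \<open>R\<close> these relations generate the rest of the ancestor order.\<close>

lemma tree_order_iff:
  assumes "bst T" "set_tree T = {a..<d}" "transp R"
  shows "(\<forall>l j r. Node l j r \<in> subtrees T \<longrightarrow> (\<forall>i \<in> set_tree l \<union> set_tree r. R i j)) \<longleftrightarrow>
    (\<forall>i \<in> {a..<d}. (\<forall>p. i < p \<and> p < succ_above T d i \<longrightarrow> R p i) \<and>
       (succ_above T d i < d \<longrightarrow> R i (succ_above T d i)))"
    (is "?tree T \<longleftrightarrow> ?chain T a d")
  using assms(1,2)
proof (induction T arbitrary: a d)
  case (Node l x r)
  note N = bst_interval_Node[OF Node.prems(1,2)]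
  note bl = succ_above_bounds[OF N(1,3)] and br = succ_above_bounds[OF N(2,4)]
  have "?tree (Node l x r) \<longleftrightarrow> ?tree l \<and> ?tree r \<and> (\<forall>i \<in> {a..<x} \<union> {Suc x..<d}. R i x)"
    using N(3,4) by auto
  also have "\<dots> \<longleftrightarrow> ?chain l a x \<and> ?chain r (Suc x) d \<and> (\<forall>i \<in> {a..<x} \<union> {Suc x..<d}. R i x)"
    using Node.IH(1)[OF N(1,3)] Node.IH(2)[OF N(2,4)] by simp
  also have "\<dots> \<longleftrightarrow> ?chain (Node l x r) a d"
  proof
    assume h: "?chain l a x \<and> ?chain r (Suc x) d \<and> (\<forall>i \<in> {a..<x} \<union> {Suc x..<d}. R i x)"
    show "?chain (Node l x r) a d"
    proof
      fix i assume i: "i \<in> {a..<d}"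
      consider "i < x" | "i = x" | "x < i" by linarith
      then show "(\<forall>p. i < p \<and> p < succ_above (Node l x r) d i \<longrightarrow> R p i) \<and>
         (succ_above (Node l x r) d i < d \<longrightarrow> R i (succ_above (Node l x r) d i))"
      proof cases
        case 1
        then have "i \<in> {a..<x}" using i by auto
        then have c: "\<And>p. i < p \<Longrightarrow> p < succ_above l x i \<Longrightarrow> R p i"
            "succ_above l x i < x \<Longrightarrow> R i (succ_above l x i)" "R i x"
          using h by auto
        show ?thesis using 1 c bl(2)[of i] i by (cases "succ_above l x i = x") auto
      next
        case 2 then show ?thesis using h by auto
      next
        case 3
        then have "i \<in> {Suc x..<d}" using i by auto
        then show ?thesis using 3 h by auto
      qed
    qed
  next
    assume h: "?chain (Node l x r) a d"
    have l: "(\<forall>p. i < p \<and> p < succ_above l x i \<longrightarrow> R p i) \<and> R i (succ_above l x i)"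
      if "i \<in> {a..<x}" for i
      using h[rule_format, of i] that N(6) bl(2)[OF that] by auto
    have r: "(\<forall>p. i < p \<and> p < succ_above r d i \<longrightarrow> R p i) \<and>
        (succ_above r d i < d \<longrightarrow> R i (succ_above r d i))" if "i \<in> {Suc x..<d}" for i
      using h[rule_format, of i] that N(5) by auto
    \<comment> \<open>Passing repeatedly to the end of the arc climbs from \<open>i\<close> to the
      root \<open>x\<close>, and transitivity collects the steps.\<close>
    have "R i x" if "i \<in> {a..<x}" for i
      using that
    proof (induction "x - i" arbitrary: i rule: less_induct)
      case less
      show ?case
      proof (cases "succ_above l x i = x")
        case True then show ?thesis using l[OF less.prems] by simp
      next
        case False
        then have "R (succ_above l x i) x"
          using less bl[OF less.prems] by (intro less.hyps) auto
        then show ?thesis using l[OF less.prems] \<open>transp R\<close> by (meson transpD)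
      qed
    qed
    moreover have "R i x" if "i \<in> {Suc x..<d}" for i
      using h[rule_format, of x] that N(5,6) by auto
    ultimately show "?chain l a x \<and> ?chain r (Suc x) d \<and> (\<forall>i \<in> {a..<x} \<union> {Suc x..<d}. R i x)"
      using l r by auto
  qed
  finally show ?case .
qed simp

text \<open>Puts the monotonicity required of an evaluation into the form in which the slope
  inequalities for \<open>steepest\<close> appear.\<close>

lemma monotone_on_tree_le_iff:
  assumes "bst T" "set_tree T = {a..<d}"
  shows "monotone_on {a..<d} (tree_le T) (\<le>) \<phi> \<longleftrightarrow>
    (\<forall>i \<in> {a..<d}. (\<forall>p. i < p \<and> p < succ_above T d i \<longrightarrow> \<phi> p \<le> \<phi> i) \<and>
       (succ_above T d i < d \<longrightarrow> \<phi> i \<le> (\<phi> (succ_above T d i) :: nat)))"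
proof -
  have "set_tree t \<subseteq> {a..<d}" if "t \<in> subtrees T" for t
    using that unfolding assms(2)[symmetric] by (induction T) auto
  then have in_range: "j \<in> {a..<d} \<and> set_tree l \<subseteq> {a..<d} \<and> set_tree r \<subseteq> {a..<d}"
    if "Node l j r \<in> subtrees T" for l j r using that by fastforce
  have "monotone_on {a..<d} (tree_le T) (\<le>) \<phi> \<longleftrightarrow>
     (\<forall>l j r. Node l j r \<in> subtrees T \<longrightarrow> (\<forall>i \<in> set_tree l \<union> set_tree r. \<phi> i \<le> \<phi> j))"
    (is "?mono \<longleftrightarrow> ?tree")
  proof
    show ?tree if ?mono
    proof (intro allI impI ballI)
      fix l j r i assume "Node l j r \<in> subtrees T" "i \<in> set_tree l \<union> set_tree r"
      then show "\<phi> i \<le> \<phi> j"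
        using in_range[of l j r] by (intro monotone_onD[OF that]) (auto simp: tree_le_def)
    qed
    show ?mono if ?tree
      using that unfolding monotone_on_def tree_le_def by auto
  qed
  then show ?thesis
    using tree_order_iff[OF assms, of "\<lambda>i j. \<phi> i \<le> \<phi> j"] by (simp add: transp_def)
qed

section \<open>Steepest slopes in a planar point sequence\<close>

text \<open>For increasing \<open>c\<close>, \<open>A i\<close> follows \<open>i\<close> on the
  upper convex hull of the points \<open>(c q, W q)\<close> with \<open>q\<close> in
  \<open>{i..n}\<close>, and \<open>M i\<close> is the slope of that hull edge. Denominators are
  cleared to keep the comparisons linear.\<close>

definition steepest ::
  "nat \<Rightarrow> (nat \<Rightarrow> real) \<Rightarrow> (nat \<Rightarrow> real) \<Rightarrow> (nat \<Rightarrow> nat) \<Rightarrow> (nat \<Rightarrow> real) \<Rightarrow> bool" where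
  "steepest n c W A M \<longleftrightarrow> (\<forall>i\<in>{1..<n}.
     A i \<in> {i<..n} \<and> W (A i) - W i = M i * (c (A i) - c i) \<and>
     (\<forall>q\<in>{i<..n}. q \<noteq> A i \<longrightarrow> W q - W i < M i * (c q - c i)))"

lemma steepestD:
  assumes "steepest n c W A M" "i \<in> {1..<n}"
  shows "i < A i" "A i \<le> n" "W (A i) - W i = M i * (c (A i) - c i)"
    and "\<And>q. i < q \<Longrightarrow> q \<le> n \<Longrightarrow> q \<noteq> A i \<Longrightarrow> W q - W i < M i * (c q - c i)"
    and "\<And>q. i < q \<Longrightarrow> q \<le> n \<Longrightarrow> W q - W i \<le> M i * (c q - c i)"
proof -
  show *: "i < A i" "A i \<le> n" "W (A i) - W i = M i * (c (A i) - c i)"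
    and less: "\<And>q. i < q \<Longrightarrow> q \<le> n \<Longrightarrow> q \<noteq> A i \<Longrightarrow> W q - W i < M i * (c q - c i)"
    using assms unfolding steepest_def by auto
  show "W q - W i \<le> M i * (c q - c i)" if "i < q" "q \<le> n" for q
    using *(3) less[OF that] by (cases "q = A i") auto
qed

context
  fixes n :: nat and c :: "nat \<Rightarrow> real"
  assumes c: "strict_mono_on {1..n} c"
begin

lemma abscissa_less: "1 \<le> i \<Longrightarrow> i < j \<Longrightarrow> j \<le> n \<Longrightarrow> c i < c j"
  using strict_mono_onD[OF c, of i j] by auto

text \<open>The point at \<open>p\<close> lies strictly below the line from \<open>i\<close> to
  \<open>A i\<close>, so the slope from \<open>p\<close> to \<open>A i\<close> exceeds
  \<open>M i\<close>, and \<open>M p\<close> is at least that slope.\<close>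

lemma steepest_slope_inside:
  assumes "steepest n c W A M" "i \<in> {1..<n}" "i < p" "p < A i"
  shows "M i < M p"
proof -
  note i = steepestD[OF assms(1,2)]
  have p: "p \<in> {1..<n}" using assms i(2) by auto
  have "W p - W i < M i * (c p - c i)" using i assms by (intro i(4)) auto
  moreover have "W (A i) - W p \<le> M p * (c (A i) - c p)"
    using i assms by (intro steepestD(5)[OF assms(1) p]) auto
  moreover have "M i * (c (A i) - c i) = M i * (c (A i) - c p) + M i * (c p - c i)"
    by (simp add: algebra_simps)
  ultimately have "M i * (c (A i) - c p) < M p * (c (A i) - c p)" using i(3) by linarith
  then show ?thesis using abscissa_less[of p "A i"] p assms i(2) by (simp add: mult_less_cancel_right)
qed

text \<open>The point at \<open>A (A i)\<close> lies strictly below the prolonged line from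
  \<open>i\<close> through \<open>A i\<close>.\<close>

lemma steepest_slope_next:
  assumes "steepest n c W A M" "i \<in> {1..<n}" "A i < n"
  shows "M (A i) < M i"
proof -
  note i = steepestD[OF assms(1,2)]
  have j: "A i \<in> {1..<n}" using assms i by auto
  note j' = steepestD[OF assms(1) j]
  have "W (A (A i)) - W i < M i * (c (A (A i)) - c i)" using i j' by (intro i(4)) auto
  moreover have "M i * (c (A (A i)) - c i) = M i * (c (A (A i)) - c (A i)) + M i * (c (A i) - c i)"
    by (simp add: algebra_simps)
  ultimately have "M (A i) * (c (A (A i)) - c (A i)) < M i * (c (A (A i)) - c (A i))"
    using i(3) j'(3) by linarith
  then show ?thesis using abscissa_less[of "A i" "A (A i)"] j j' by (simp add: mult_less_cancel_right)
qed

text \<open>If \<open>A p\<close> were beyond \<open>A i\<close>, the slope from \<open>A i\<close>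
  to \<open>A p\<close> would be below \<open>M i\<close> and above \<open>M p\<close>,
  contradicting \<open>steepest_slope_inside\<close>.\<close>

lemma steepest_noncrossing:
  assumes "steepest n c W A M" "i \<in> {1..<n}" "i < p" "p < A i"
  shows "A p \<le> A i"
proof (rule ccontr)
  assume "\<not> A p \<le> A i"
  then have q: "A i < A p" by simp
  note i = steepestD[OF assms(1,2)]
  have p: "p \<in> {1..<n}" using assms i(2) by auto
  note p' = steepestD[OF assms(1) p]
  have "W (A p) - W i < M i * (c (A p) - c i)" using i p' q by (intro i(4)) auto
  moreover have "W (A i) - W p < M p * (c (A i) - c p)" using i assms q by (intro p'(4)) auto
  moreover have "M i * (c (A p) - c i) = M i * (c (A p) - c (A i)) + M i * (c (A i) - c i)"
    "M p * (c (A p) - c p) = M p * (c (A p) - c (A i)) + M p * (c (A i) - c p)"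
    by (simp_all add: algebra_simps)
  ultimately have "M p * (c (A p) - c (A i)) < M i * (c (A p) - c (A i))"
    using i(3) p'(3) by linarith
  then have "M p < M i" using abscissa_less[of "A i" "A p"] q i p' assms by (simp add: mult_less_cancel_right)
  then show False using steepest_slope_inside[OF assms] by simp
qed

text \<open>Converse of the three lemmas above. The equations along the arcs fix \<open>W\<close>
  from right to left; the inequalities follow by comparing slopes along chains of arcs.\<close>

lemma steepest_exists:
  assumes A: "\<And>i. i \<in> {1..<n} \<Longrightarrow> i < A i \<and> A i \<le> n"
    and noncrossing: "\<And>i p. i \<in> {1..<n} \<Longrightarrow> i < p \<Longrightarrow> p < A i \<Longrightarrow> A p \<le> A i"
    and inside: "\<And>i p. i \<in> {1..<n} \<Longrightarrow> i < p \<Longrightarrow> p < A i \<Longrightarrow> M i < M p"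
    and at_target: "\<And>i. i \<in> {1..<n} \<Longrightarrow> A i < n \<Longrightarrow> M (A i) < M i"
  shows "\<exists>W. steepest n c W A M"
proof -
  \<comment> \<open>The equation at \<open>i\<close> determines \<open>W i\<close> from the value at
    the larger index \<open>A i\<close>, so an update at \<open>n - Suc m\<close> disturbs no
    equation already solved. The value at \<open>n\<close> is free.\<close>
  have "\<exists>W. \<forall>i\<in>{1..<n}. n - m \<le> i \<longrightarrow> W (A i) - W i = M i * (c (A i) - c i)" for m
  proof (induction m)
    case (Suc m)
    then obtain W where W: "\<And>i. i \<in> {1..<n} \<Longrightarrow> n - m \<le> i \<Longrightarrow> W (A i) - W i = M i * (c (A i) - c i)"
      by blast
    let ?i = "n - Suc m"
    have "(W(?i := W (A ?i) - M ?i * (c (A ?i) - c ?i))) (A i) -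
        (W(?i := W (A ?i) - M ?i * (c (A ?i) - c ?i))) i = M i * (c (A i) - c i)"
      if "i \<in> {1..<n}" "?i \<le> i" for i
      using W[of i] A[of i] that by (cases "i = ?i") auto
    then show ?case by blast
  qed auto
  from this[of n] obtain W where "\<forall>i\<in>{1..<n}. W (A i) - W i = M i * (c (A i) - c i)"
    by auto
  then have W: "\<And>i. i \<in> {1..<n} \<Longrightarrow> W (A i) - W i = M i * (c (A i) - c i)" by blast
  have "W q - W i < M i * (c q - c i)" if "i \<in> {1..<n}" "i < q" "q \<le> n" "q \<noteq> A i" for i q
    using that
  proof (induction "n - i" arbitrary: i q rule: less_induct)
    case less
    note i = less.prems(1)
    show ?case
    proof (cases "q < A i")
      case True
      \<comment> \<open>For targets under the arc: by noncrossing, the arcs from \<open>p\<close>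
        lead to \<open>A i\<close> without overshooting, and each is steeper than
        \<open>M i\<close>.\<close>
      have "M i * (c (A i) - c p) < W (A i) - W p" if "i < p" "p < A i" for p
        using that
      proof (induction "A i - p" arbitrary: p rule: less_induct)
        case (less p)
        have p: "p \<in> {1..<n}" using less.prems i A[OF i] by auto
        have "M i < M p" using inside[OF i less.prems] .
        moreover have "c p < c (A p)" using p A[OF p] by (intro abscissa_less) auto
        ultimately have "M i * (c (A p) - c p) < M p * (c (A p) - c p)" by simp
        also have "\<dots> = W (A p) - W p" using W[OF p] by simp
        finally have step: "M i * (c (A p) - c p) < W (A p) - W p" .
        show ?case
        proof (cases "A p = A i")
          case True then show ?thesis using step by simp
        next
          case False
          then have "M i * (c (A i) - c (A p)) < W (A i) - W (A p)"
            using noncrossing[OF i less.prems] A[OF p] less.prems by (intro less.hyps) auto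
          then show ?thesis using step by (simp add: algebra_simps)
        qed
      qed
      from this[OF less.prems(2) True] show ?thesis using W[OF i] by (simp add: algebra_simps)
    next
      case False
      then have j: "A i \<in> {1..<n}" "A i < q" "A i < n" using less.prems A[OF i] by auto
      \<comment> \<open>For targets beyond \<open>A i\<close>: the induction hypothesis at
        \<open>A i\<close> bounds the height at \<open>q\<close> by a line of slope
        \<open>M (A i)\<close>, which is flatter than \<open>M i\<close>.\<close>
      have "W q - W (A i) \<le> M (A i) * (c q - c (A i))"
      proof (cases "q = A (A i)")
        case True then show ?thesis using W[OF j(1)] by simp
      next
        case False
        then have "W q - W (A i) < M (A i) * (c q - c (A i))"
          using j less.prems A[OF i] by (intro less.hyps) auto
        then show ?thesis by simp
      qed
      also have "\<dots> < M i * (c q - c (A i))"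
        using at_target[OF i j(3)] abscissa_less[of "A i" q] j less.prems by simp
      finally show ?thesis using W[OF i] by (simp add: algebra_simps)
    qed
  qed
  then have "steepest n c W A M" unfolding steepest_def using W A by auto
  then show ?thesis by blast
qed

end

section \<open>The edges of simplex times cube\<close>

locale simplex_cube =
  fixes n k :: nat and b :: "nat \<Rightarrow> 'a::euclidean_space" and c r :: "nat \<Rightarrow> real"
  assumes n: "n \<ge> 1"
    and b: "bij_betw b {1..n + k} Basis"
    and c: "strict_mono_on {1..n} c"
    and r: "\<forall>j\<in>{1..k}. r j > 0"
begin

declare One_nat_def [simp del]

abbreviation "Q \<equiv> simplex_times_cube b n k"
abbreviation "obj \<equiv> objective b n k c r"

section \<open>Coordinates and faces\<close>

lemma inner_b:
  assumes "p \<in> {1..n + k}" "q \<in> {1..n + k}"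
  shows "b p \<bullet> b q = of_bool (p = q)"
proof -
  have "b p \<in> Basis" "b q \<in> Basis" using bij_betwE[OF b] assms by auto
  moreover have "b p = b q \<longleftrightarrow> p = q"
    using bij_betw_imp_inj_on[OF b] assms by (rule inj_on_eq_iff)
  ultimately show ?thesis by (simp add: inner_Basis)
qed

lemma eqI_b:
  assumes "\<And>i. i \<in> {1..n} \<Longrightarrow> x \<bullet> b i = y \<bullet> b i"
    and "\<And>j. j \<in> {1..k} \<Longrightarrow> x \<bullet> b (n + j) = y \<bullet> b (n + j)"
  shows "x = y"
proof (rule euclidean_eqI)
  fix a :: 'a assume "a \<in> Basis"
  then obtain p where p: "p \<in> {1..n + k}" "a = b p" using b unfolding bij_betw_def by blast
  show "x \<bullet> a = y \<bullet> a"
  proof (cases "p \<le> n")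
    case True then show ?thesis using assms(1)[of p] p by simp
  next
    case False
    then have "p - n \<in> {1..k}" "n + (p - n) = p" using p by auto
    then show ?thesis using assms(2)[of "p - n"] p by simp
  qed
qed

lemma inner_sum_b:
  assumes "P \<subseteq> {1..n + k}" "q \<in> {1..n + k}"
  shows "(\<Sum>p\<in>P. f p *\<^sub>R b p) \<bullet> b q = (if q \<in> P then f q else 0)"
proof -
  have "(\<Sum>p\<in>P. f p *\<^sub>R b p) \<bullet> b q = (\<Sum>p\<in>P. if q = p then f p else 0)"
    unfolding inner_sum_left by (intro sum.cong refl) (use assms inner_b in auto)
  then show ?thesis using finite_subset[OF assms(1)] by simp
qed

lemma inner_sum_b_cube:
  assumes "S \<subseteq> {1..k}"
  shows "i \<in> {1..n} \<Longrightarrow> (\<Sum>l\<in>S. f l *\<^sub>R b (n + l)) \<bullet> b i = 0"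
    and "j \<in> {1..k} \<Longrightarrow> (\<Sum>l\<in>S. f l *\<^sub>R b (n + l)) \<bullet> b (n + j) = (if j \<in> S then f j else 0)"
proof -
  have eq: "(\<Sum>l\<in>S. f l *\<^sub>R b (n + l)) = (\<Sum>p\<in>(+) n ` S. f (p - n) *\<^sub>R b p)"
    by (subst sum.reindex) (auto simp: inj_on_def)
  have sub: "(+) n ` S \<subseteq> {1..n + k}" using assms by auto
  show "i \<in> {1..n} \<Longrightarrow> (\<Sum>l\<in>S. f l *\<^sub>R b (n + l)) \<bullet> b i = 0"
    unfolding eq by (subst inner_sum_b[OF sub]) (use assms in auto)
  show "j \<in> {1..k} \<Longrightarrow> (\<Sum>l\<in>S. f l *\<^sub>R b (n + l)) \<bullet> b (n + j) = (if j \<in> S then f j else 0)"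
    unfolding eq by (subst inner_sum_b[OF sub]) (use assms in auto)
qed

lemma mem_simplexD:
  assumes "x \<in> convex hull (b ` {1..n})"
  shows "i \<in> {1..n} \<Longrightarrow> 0 \<le> x \<bullet> b i" "(\<Sum>i\<in>{1..n}. x \<bullet> b i) = 1"
    and "j \<in> {1..k} \<Longrightarrow> x \<bullet> b (n + j) = 0"
proof -
  let ?C = "{x. (\<forall>i\<in>{1..n}. 0 \<le> x \<bullet> b i) \<and> (\<Sum>i\<in>{1..n}. x \<bullet> b i) = 1 \<and>
    (\<forall>j\<in>{1..k}. x \<bullet> b (n + j) = 0)}"
  have "convex ?C"
    unfolding convex_def by (auto simp: inner_add_left sum.distrib sum_distrib_left[symmetric])
  moreover have "b ` {1..n} \<subseteq> ?C"
  proof (rule image_subsetI)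
    fix p assume p: "p \<in> {1..n}"
    have "(\<Sum>i\<in>{1..n}. b p \<bullet> b i) = (\<Sum>i\<in>{1..n}. if i = p then 1 else 0)"
      using p by (intro sum.cong) (auto simp: inner_b)
    then show "b p \<in> ?C" using p by (auto simp: inner_b)
  qed
  ultimately have "x \<in> ?C" using assms hull_minimal[of "b ` {1..n}" ?C convex] by blast
  then show "i \<in> {1..n} \<Longrightarrow> 0 \<le> x \<bullet> b i" "(\<Sum>i\<in>{1..n}. x \<bullet> b i) = 1"
    "j \<in> {1..k} \<Longrightarrow> x \<bullet> b (n + j) = 0" by auto
qed

lemma mem_Q:
  "x \<in> Q \<longleftrightarrow> (\<forall>i\<in>{1..n}. 0 \<le> x \<bullet> b i) \<and> (\<Sum>i\<in>{1..n}. x \<bullet> b i) = 1 \<and>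
     (\<forall>j\<in>{1..k}. 0 \<le> x \<bullet> b (n + j) \<and> x \<bullet> b (n + j) \<le> 1)" (is "_ \<longleftrightarrow> ?coords")
proof
  assume "x \<in> Q"
  then obtain y t where x: "x = y + (\<Sum>j\<in>{1..k}. t j *\<^sub>R b (n + j))"
    and y: "y \<in> convex hull (b ` {1..n})" and t: "\<forall>j\<in>{1..k}. t j \<in> {0..1}"
    unfolding simplex_times_cube_def by blast
  have "x \<bullet> b i = y \<bullet> b i" if "i \<in> {1..n}" for i
    using inner_sum_b_cube(1)[OF order_refl that] by (simp add: x inner_add_left)
  moreover have "x \<bullet> b (n + j) = t j" if "j \<in> {1..k}" for j
    using inner_sum_b_cube(2)[OF order_refl that] mem_simplexD(3)[OF y that] that
    by (simp add: x inner_add_left)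
  ultimately show ?coords using mem_simplexD[OF y] t by simp
next
  assume x: ?coords
  define y where "y = (\<Sum>i\<in>{1..n}. (x \<bullet> b i) *\<^sub>R b i)"
  have "y \<in> convex hull (b ` {1..n})"
    unfolding y_def using x by (intro convex_sum) (auto intro: hull_inc)
  moreover have "x = y + (\<Sum>j\<in>{1..k}. (x \<bullet> b (n + j)) *\<^sub>R b (n + j))"
    by (rule eqI_b) (auto simp: y_def inner_add_left inner_sum_b inner_sum_b_cube)
  ultimately show "x \<in> Q"
    unfolding simplex_times_cube_def using x
    by (intro CollectI exI[of _ y] exI[of _ "\<lambda>j. x \<bullet> b (n + j)"]) auto
qed

text \<open>If a convex combination with positive weights attains the bound of a coordinate, so do
  both ends. Vertices and edges arise by fixing all coordinates but one or two.\<close>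

lemma Q_face:
  assumes "I \<subseteq> {1..n}" "Z \<subseteq> {1..k}" "U \<subseteq> {1..k}"
  shows "{x \<in> Q. (\<forall>i\<in>I. x \<bullet> b i = 0) \<and> (\<forall>j\<in>Z. x \<bullet> b (n + j) = 0) \<and>
    (\<forall>j\<in>U. x \<bullet> b (n + j) = 1)} face_of Q" (is "?F face_of Q")
  unfolding face_of_def
proof (intro conjI ballI impI)
  have "convex Q"
    unfolding convex_def
  proof (intro ballI allI impI)
    fix x y :: 'a and u v :: real
    assume "x \<in> Q" "y \<in> Q" and uv: "0 \<le> u" "0 \<le> v" "u + v = 1"
    then show "u *\<^sub>R x + v *\<^sub>R y \<in> Q"
      unfolding mem_Q
      by (auto simp: inner_add_left sum.distrib sum_distrib_left[symmetric] intro: convex_bound_le)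
  qed
  moreover have "convex {x. (\<forall>i\<in>I. x \<bullet> b i = 0) \<and> (\<forall>j\<in>Z. x \<bullet> b (n + j) = 0) \<and>
    (\<forall>j\<in>U. x \<bullet> b (n + j) = 1)}"
    unfolding convex_def by (auto simp: inner_add_left)
  ultimately show "convex ?F" by (simp add: convex_Int Collect_conj_eq)
  fix x y z assume x: "x \<in> Q" and y: "y \<in> Q" and z: "z \<in> ?F" and "z \<in> open_segment x y"
  then obtain u where u: "0 < u" "u < 1" and zxy: "z = (1 - u) *\<^sub>R x + u *\<^sub>R y"
    by (auto simp: in_segment)
  have zero: "x \<bullet> a = 0 \<and> y \<bullet> a = 0" if "z \<bullet> a = 0" "0 \<le> x \<bullet> a" "0 \<le> y \<bullet> a" for a
  proof -
    have "(1 - u) * (x \<bullet> a) + u * (y \<bullet> a) = 0" using that(1) by (simp add: zxy inner_add_left)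
    then show ?thesis
      using that u add_nonneg_eq_0_iff[of "(1 - u) * (x \<bullet> a)" "u * (y \<bullet> a)"] by auto
  qed
  have one: "x \<bullet> a = 1 \<and> y \<bullet> a = 1" if "z \<bullet> a = 1" "x \<bullet> a \<le> 1" "y \<bullet> a \<le> 1" for a
  proof -
    have "(1 - u) * (1 - x \<bullet> a) + u * (1 - y \<bullet> a) = 0"
      using that(1) by (simp add: zxy inner_add_left algebra_simps)
    then show ?thesis
      using that u add_nonneg_eq_0_iff[of "(1 - u) * (1 - x \<bullet> a)" "u * (1 - y \<bullet> a)"] by auto
  qed
  have "x \<bullet> b i = 0 \<and> y \<bullet> b i = 0" if "i \<in> I" for i
    by (rule zero) (use z x[unfolded mem_Q] y[unfolded mem_Q] that assms(1) in blast)+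
  moreover have "x \<bullet> b (n + j) = 0 \<and> y \<bullet> b (n + j) = 0" if "j \<in> Z" for j
    by (rule zero) (use z x[unfolded mem_Q] y[unfolded mem_Q] that assms(2) in blast)+
  moreover have "x \<bullet> b (n + j) = 1 \<and> y \<bullet> b (n + j) = 1" if "j \<in> U" for j
    by (rule one) (use z x[unfolded mem_Q] y[unfolded mem_Q] that assms(3) in blast)+
  ultimately show "x \<in> ?F" "y \<in> ?F" using x y by auto
qed auto

section \<open>Vertices\<close>

definition vert :: "nat \<Rightarrow> nat set \<Rightarrow> 'a" where
  "vert i S = b i + (\<Sum>l\<in>S. b (n + l))"

abbreviation "idx \<equiv> {1..n} \<times> Pow {1..k}"

lemma inner_vert:
  assumes "i \<in> {1..n}" "S \<subseteq> {1..k}"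
  shows "p \<in> {1..n} \<Longrightarrow> vert i S \<bullet> b p = of_bool (p = i)"
    and "j \<in> {1..k} \<Longrightarrow> vert i S \<bullet> b (n + j) = of_bool (j \<in> S)"
  using assms inner_sum_b_cube[OF assms(2), of _ "\<lambda>_. 1"]
  by (auto simp: vert_def inner_add_left inner_b)

lemma vert_inject:
  assumes "i \<in> {1..n}" "S \<subseteq> {1..k}" "j \<in> {1..n}" "T \<subseteq> {1..k}"
  shows "vert i S = vert j T \<longleftrightarrow> i = j \<and> S = T"
proof
  assume eq: "vert i S = vert j T"
  have "i = j"
    using inner_vert(1)[OF assms(1,2,1)] inner_vert(1)[OF assms(3,4,1)] by (simp add: eq)
  moreover have "l \<in> S \<longleftrightarrow> l \<in> T" if "l \<in> {1..k}" for l
    using inner_vert(2)[OF assms(1,2) that] inner_vert(2)[OF assms(3,4) that]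
    by (auto simp: eq of_bool_def split: if_splits)
  ultimately show "i = j \<and> S = T" using assms by blast
qed simp

lemma vert_in_Q:
  assumes "i \<in> {1..n}" "S \<subseteq> {1..k}"
  shows "vert i S \<in> Q"
proof -
  have "(\<Sum>p\<in>{1..n}. vert i S \<bullet> b p) = (\<Sum>p\<in>{1..n}. if p = i then 1 else 0)"
    by (intro sum.cong) (use assms in \<open>auto simp: inner_vert\<close>)
  also have "\<dots> = 1" using assms(1) by simp
  finally show ?thesis using inner_vert[OF assms] by (auto simp: mem_Q)
qed

text \<open>With all coordinates but \<open>i\<close> fixed, the sum condition forces the remaining
  one to be 1, so the face is a point.\<close>

lemma vert_extreme:
  assumes "i \<in> {1..n}" "S \<subseteq> {1..k}"
  shows "vert i S extreme_point_of Q"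
proof -
  let ?F = "{x \<in> Q. (\<forall>p\<in>{1..n} - {i}. x \<bullet> b p = 0) \<and> (\<forall>j\<in>{1..k} - S. x \<bullet> b (n + j) = 0) \<and>
    (\<forall>j\<in>S. x \<bullet> b (n + j) = 1)}"
  have "?F = {vert i S}"
  proof (intro equalityI subsetI)
    fix x assume x: "x \<in> ?F"
    have "(\<Sum>p\<in>{1..n}. x \<bullet> b p) = x \<bullet> b i"
      using x assms(1) by (subst sum.remove[of _ i]) auto
    then have "x \<bullet> b i = 1" using x by (simp add: mem_Q)
    then have "x = vert i S" using x assms by (intro eqI_b) (auto simp: inner_vert)
    then show "x \<in> {vert i S}" by simp
  qed (use assms vert_in_Q in \<open>auto simp: inner_vert subset_iff\<close>)
  then show ?thesis using Q_face[of "{1..n} - {i}" "{1..k} - S" S] assms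
    by (simp add: face_of_singleton)
qed

text \<open>A cube coordinate strictly between 0 and 1, or two nonzero simplex coordinates, would
  leave room to move \<open>x\<close> in opposite directions.\<close>

lemma extreme_is_vert:
  assumes "x extreme_point_of Q"
  shows "\<exists>i\<in>{1..n}. \<exists>S\<subseteq>{1..k}. x = vert i S"
proof -
  have x: "x \<in> Q" using assms by (simp add: extreme_point_of_def)
  have perturb: False if "x + d \<in> Q" "x - d \<in> Q" "d \<noteq> 0" for d
  proof -
    have "x - d \<noteq> x + d"
    proof
      assume "x - d = x + d"
      then have "2 *\<^sub>R d = 0" by (simp add: scaleR_2 algebra_simps)
      then show False using that(3) by simp
    qed
    moreover have "x = (1 - 1/2) *\<^sub>R (x - d) + (1/2) *\<^sub>R (x + d)"
      by (simp add: scaleR_add_right scaleR_diff_right flip: scaleR_add_left)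
    ultimately have "x \<in> open_segment (x - d) (x + d)"
      unfolding in_segment by (intro conjI exI[of _ "1/2"]) auto
    then show False using assms that by (auto simp: extreme_point_of_def)
  qed
  have cube: "x \<bullet> b (n + j) = 0 \<or> x \<bullet> b (n + j) = 1" if j: "j \<in> {1..k}" for j
  proof (rule ccontr)
    assume *: "\<not> ?thesis"
    define e where "e = min (x \<bullet> b (n + j)) (1 - x \<bullet> b (n + j))"
    have e: "0 < e" "e \<le> x \<bullet> b (n + j)" "x \<bullet> b (n + j) + e \<le> 1"
      using * x j unfolding mem_Q e_def by (auto simp: less_le)
    have "b (n + j) \<bullet> b i = 0" if "i \<in> {1..n}" for i using that j by (simp add: inner_b)
    moreover have "b (n + j) \<bullet> b (n + l) = of_bool (j = l)" if "l \<in> {1..k}" for l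
      using that j by (simp add: inner_b)
    ultimately have "x + e *\<^sub>R b (n + j) \<in> Q" "x - e *\<^sub>R b (n + j) \<in> Q"
      using x e unfolding mem_Q by (auto simp: inner_add_left inner_diff_left)
    moreover have "e *\<^sub>R b (n + j) \<noteq> 0" using e b j by (auto simp: bij_betw_def nonzero_Basis)
    ultimately show False using perturb by blast
  qed
  have "\<exists>i\<in>{1..n}. x \<bullet> b i \<noteq> 0"
  proof (rule ccontr)
    assume "\<not> ?thesis"
    then have "(\<Sum>i\<in>{1..n}. x \<bullet> b i) = 0" by simp
    then show False using x by (simp add: mem_Q)
  qed
  then obtain i where i: "i \<in> {1..n}" "x \<bullet> b i \<noteq> 0" by blast
  have other: "x \<bullet> b q = 0" if q: "q \<in> {1..n}" "q \<noteq> i" for q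
  proof (rule ccontr)
    assume *: "x \<bullet> b q \<noteq> 0"
    define e where "e = min (x \<bullet> b i) (x \<bullet> b q)"
    have e: "0 < e" "e \<le> x \<bullet> b i" "e \<le> x \<bullet> b q"
      using * x i q unfolding mem_Q e_def by (auto simp: less_le)
    \<comment> \<open>Moving along \<open>d\<close> shifts mass from \<open>q\<close> to
      \<open>i\<close> and keeps the coordinate sum; \<open>e\<close> is small enough for both
      directions.\<close>
    define d where "d = e *\<^sub>R (b i - b q)"
    have d: "d \<bullet> b p = (if p = i then e else if p = q then - e else 0)" if "p \<in> {1..n}" for p
      using that i q by (auto simp: d_def inner_diff_left inner_b)
    have d': "d \<bullet> b (n + j) = 0" if "j \<in> {1..k}" for j
      using that i q by (auto simp: d_def inner_diff_left inner_b)
    have "(\<Sum>p\<in>{1..n}. d \<bullet> b p) = (\<Sum>p\<in>{1..n}. (if p = i then e else 0) - (if p = q then e else 0))"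
      by (intro sum.cong) (use d q in auto)
    then have "(\<Sum>p\<in>{1..n}. d \<bullet> b p) = 0" using i q by (simp add: sum_subtractf)
    moreover have "0 \<le> x \<bullet> b p + d \<bullet> b p" "0 \<le> x \<bullet> b p - d \<bullet> b p" if "p \<in> {1..n}" for p
      using x that e d[OF that] i q unfolding mem_Q by auto
    ultimately have "x + d \<in> Q" "x - d \<in> Q"
      using x d' unfolding mem_Q inner_add_left inner_diff_left sum.distrib sum_subtractf by auto
    moreover have "d \<noteq> 0" using e d[OF i(1)] by auto
    ultimately show False using perturb by blast
  qed
  have "(\<Sum>p\<in>{1..n}. x \<bullet> b p) = x \<bullet> b i"
    using other i(1) by (subst sum.remove[of _ i]) auto
  then have xi: "x \<bullet> b i = 1" using x by (simp add: mem_Q)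
  define S where "S = {j \<in> {1..k}. x \<bullet> b (n + j) = 1}"
  have S: "S \<subseteq> {1..k}" by (auto simp: S_def)
  have "x = vert i S"
  proof (rule eqI_b)
    show "x \<bullet> b p = vert i S \<bullet> b p" if "p \<in> {1..n}" for p
      using other[OF that] xi inner_vert(1)[OF i(1) S that] by auto
    show "x \<bullet> b (n + j) = vert i S \<bullet> b (n + j)" if "j \<in> {1..k}" for j
      using cube[OF that] that inner_vert(2)[OF i(1) S that] by (auto simp: S_def)
  qed
  then show ?thesis using i(1) S by blast
qed

lemma vertices_Q: "vertices Q = (\<lambda>(i, S). vert i S) ` idx"
  unfolding vertices_def using extreme_is_vert vert_extreme by fastforce

lemma finite_vertices_Q: "finite (vertices Q)"
  unfolding vertices_Q by simp


section \<open>The objective function and its maximiser\<close>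

lemma inner_obj: "obj \<bullet> x = (\<Sum>i\<in>{1..n}. c i * (x \<bullet> b i)) + (\<Sum>j\<in>{1..k}. r j * (x \<bullet> b (n + j)))"
  by (simp add: objective_def inner_add_left inner_sum_left inner_commute[of x])

lemma inner_obj_vert:
  assumes "i \<in> {1..n}" "S \<subseteq> {1..k}"
  shows "obj \<bullet> vert i S = c i + sum r S"
proof -
  have "(\<Sum>p\<in>{1..n}. c p * (vert i S \<bullet> b p)) = (\<Sum>p\<in>{1..n}. if p = i then c p else 0)"
    by (intro sum.cong) (use assms in \<open>auto simp: inner_vert\<close>)
  moreover have "(\<Sum>j\<in>{1..k}. r j * (vert i S \<bullet> b (n + j))) = (\<Sum>j\<in>S. r j)"
    by (rule sum.mono_neutral_cong_right) (use assms in \<open>auto simp: inner_vert subset_iff\<close>)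
  ultimately show ?thesis using assms by (simp add: inner_obj)
qed

lemmas c_less = abscissa_less[OF c]

text \<open>The simplex part of the objective is a weighted mean of the \<open>c i\<close>, the cube
  part at most the sum of all \<open>r j\<close>. At another maximal vertex both deficits vanish,
  which forces index \<open>n\<close> and the full set.\<close>

lemma v_opt_Q: "v_opt Q obj = vert n {1..k}"
  unfolding v_opt_def
proof (rule the_equality)
  have top: "n \<in> {1..n}" using n by simp
  have "obj \<bullet> x \<le> obj \<bullet> vert n {1..k}" if "x \<in> Q" for x
  proof -
    have "(\<Sum>i\<in>{1..n}. c i * (x \<bullet> b i)) \<le> (\<Sum>i\<in>{1..n}. c n * (x \<bullet> b i))"
    proof (intro sum_mono mult_right_mono)
      fix i assume i: "i \<in> {1..n}"
      show "c i \<le> c n" using c_less[of i n] i by (cases "i = n") auto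
      show "0 \<le> x \<bullet> b i" using that i by (simp add: mem_Q)
    qed
    also have "\<dots> = c n" using that by (simp add: mem_Q sum_distrib_left[symmetric])
    finally have 1: "(\<Sum>i\<in>{1..n}. c i * (x \<bullet> b i)) \<le> c n" .
    have "(\<Sum>j\<in>{1..k}. r j * (x \<bullet> b (n + j))) \<le> (\<Sum>j\<in>{1..k}. r j)"
      using that r by (intro sum_mono) (auto simp: mem_Q mult_left_le less_imp_le)
    then show ?thesis
      using 1 unfolding inner_obj[of x] inner_obj_vert[OF top order_refl] by linarith
  qed
  then show "vert n {1..k} \<in> vertices Q \<and> (\<forall>x\<in>Q. obj \<bullet> x \<le> obj \<bullet> vert n {1..k})"
    using vert_extreme[OF top] by (simp add: vertices_def)
  fix v assume v: "v \<in> vertices Q \<and> (\<forall>x\<in>Q. obj \<bullet> x \<le> obj \<bullet> v)"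
  then obtain i S where iS: "i \<in> {1..n}" "S \<subseteq> {1..k}" "v = vert i S"
    unfolding vertices_Q by auto
  have "obj \<bullet> vert n {1..k} \<le> obj \<bullet> v" using v vert_in_Q[OF top] by blast
  then have le: "c n + sum r {1..k} \<le> c i + sum r S"
    using iS top by (simp add: inner_obj_vert)
  have "sum r {1..k} = sum r S + sum r ({1..k} - S)"
    using iS(2) by (simp add: sum.subset_diff)
  moreover have "0 \<le> sum r ({1..k} - S)" using r by (intro sum_nonneg) (auto intro: less_imp_le)
  moreover have "c i \<le> c n" using c_less[of i n] iS by (cases "i = n") auto
  ultimately have "c i = c n" "sum r ({1..k} - S) = 0" using le by linarith+
  then have "i = n" "{1..k} - S = {}"
    using c_less[of i n] iS sum_pos[of "{1..k} - S" r] r by (force simp: le_less)+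
  then show "v = vert n {1..k}" using iS by auto
qed

section \<open>Edges and their orientation\<close>

text \<open>Both pairs have the same midpoint, and a face containing an interior point of a segment
  in \<open>Q\<close> contains its ends.\<close>

lemma face_segment_swap:
  assumes "closed_segment u v face_of Q" "p \<in> Q" "q \<in> Q" "p + q = u + v"
  shows "p \<in> closed_segment u v"
proof (cases "p = q")
  case True
  then have "u + v = 2 *\<^sub>R p" using assms(4) by (simp add: scaleR_2)
  then have "(1/2) *\<^sub>R (u + v) = p" by simp
  then have "p = (1 - 1/2) *\<^sub>R u + (1/2) *\<^sub>R v" by (simp add: scaleR_add_right)
  then show ?thesis unfolding in_segment by (intro exI[of _ "1/2"]) auto
next
  case False
  let ?m = "(1/2) *\<^sub>R (u + v)"
  have "?m \<in> closed_segment u v"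
    unfolding in_segment by (intro exI[of _ "1/2"]) (auto simp: scaleR_add_right)
  moreover have "?m \<in> open_segment p q"
    unfolding in_segment assms(4)[symmetric]
    using False by (intro conjI exI[of _ "1/2"]) (auto simp: scaleR_add_right)
  ultimately show ?thesis using face_ofD[OF assms(1)] assms by blast
qed

text \<open>Exchanging only part of the coordinates in which two vertices differ gives another pair
  of vertices with the same sum, which \<open>face_segment_swap\<close> forbids on an edge.\<close>

lemma adjacent_vert_cases:
  assumes i: "i \<in> {1..n}" "S \<subseteq> {1..k}" and j: "j \<in> {1..n}" "T \<subseteq> {1..k}"
    and adj: "adjacent Q (vert i S) (vert j T)"
  shows "S = T \<or> (i = j \<and> (\<exists>l. sym_diff S T = {l}))"
proof (rule ccontr)
  assume *: "\<not> ?thesis"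
  have face: "closed_segment (vert i S) (vert j T) face_of Q"
    using adj by (simp add: adjacent_def edge_of_def)
  obtain l where l: "l \<in> sym_diff S T" using * by blast
  \<comment> \<open>For \<open>i = j\<close> only the cube coordinate \<open>l\<close> is exchanged,
    otherwise only the simplex index.\<close>
  define S' T' where "S' = (if i = j then sym_diff S {l} else S)"
    and "T' = (if i = j then sym_diff T {l} else T)"
  have sub: "S' \<subseteq> {1..k}" "T' \<subseteq> {1..k}" using i j l by (auto simp: S'_def T'_def)
  have "vert j S' \<in> closed_segment (vert i S) (vert j T)"
  proof (rule face_segment_swap[OF face])
    show "vert j S' \<in> Q" "vert i T' \<in> Q" using vert_in_Q i j sub by auto
    show "vert j S' + vert i T' = vert i S + vert j T"
      by (rule eqI_b) (use l i j sub in \<open>auto simp: inner_add_left inner_vert S'_def T'_def\<close>)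
  qed
  then obtain t where t: "vert j S' = (1 - t) *\<^sub>R vert i S + t *\<^sub>R vert j T"
    by (auto simp: in_segment)
  have "t = 1"
  proof (cases "i = j")
    case True
    have "l \<in> {1..k}" using l i j by auto
    then have "vert j S' \<bullet> b (n + l) = (1 - t) * of_bool (l \<in> S) + t * of_bool (l \<in> T)"
      unfolding t using i j by (simp add: inner_add_left inner_vert)
    then show ?thesis using True l \<open>l \<in> {1..k}\<close> inner_vert(2)[OF j(1) sub(1), of l]
      by (auto simp: S'_def)
  next
    case False
    have "vert j S' \<bullet> b j = t"
      unfolding t using False i j by (simp add: inner_add_left inner_vert)
    then show ?thesis using j sub by (simp add: inner_vert)
  qed
  then have "S' = T" using t vert_inject[OF j(1) sub(1) j] by simp
  then show False using * l by (auto simp: S'_def split: if_splits)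
qed

lemma segment_edge:
  assumes "closed_segment u v face_of Q" "u \<noteq> v"
  shows "adjacent Q u v"
proof -
  have "aff_dim (closed_segment u v) = 1"
    using assms(2) aff_dim_convex_hull[of "{u, v}"] by (simp add: segment_convex_hull)
  then show ?thesis using assms by (simp add: adjacent_def edge_of_def)
qed

text \<open>The face leaving only the simplex coordinates \<open>i\<close> and \<open>j\<close> free
  is this segment, since they sum to 1.\<close>

lemma adjacent_simplex_edge:
  assumes i: "i \<in> {1..n}" "S \<subseteq> {1..k}" and j: "j \<in> {1..n}" "i \<noteq> j"
  shows "adjacent Q (vert i S) (vert j S)"
proof (rule segment_edge)
  show "vert i S \<noteq> vert j S" using vert_inject[OF i j(1) i(2)] j by simp
  let ?F = "{x \<in> Q. (\<forall>p\<in>{1..n} - {i, j}. x \<bullet> b p = 0) \<and> (\<forall>l\<in>{1..k} - S. x \<bullet> b (n + l) = 0) \<and>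
    (\<forall>l\<in>S. x \<bullet> b (n + l) = 1)}"
  have face: "?F face_of Q" using i j by (intro Q_face) auto
  have "closed_segment (vert i S) (vert j S) \<subseteq> ?F"
    using i j vert_in_Q face_of_imp_convex[OF face]
    by (intro closed_segment_subset) (auto simp: inner_vert subset_iff)
  moreover have "x \<in> closed_segment (vert i S) (vert j S)" if x: "x \<in> ?F" for x
  proof -
    have "(\<Sum>p\<in>{1..n}. x \<bullet> b p) = x \<bullet> b i + x \<bullet> b j + (\<Sum>p\<in>{1..n} - {i} - {j}. x \<bullet> b p)"
      using i j by (subst sum.remove[of _ i], simp, simp, subst sum.remove[of _ j]) auto
    also have "(\<Sum>p\<in>{1..n} - {i} - {j}. x \<bullet> b p) = 0" using x by (intro sum.neutral) auto
    finally have xi: "x \<bullet> b i = 1 - x \<bullet> b j" using x by (simp add: mem_Q)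
    have "x = (1 - x \<bullet> b j) *\<^sub>R vert i S + (x \<bullet> b j) *\<^sub>R vert j S"
      by (rule eqI_b) (use x xi i j in \<open>auto simp: inner_vert inner_add_left\<close>)
    moreover have "0 \<le> x \<bullet> b j" "0 \<le> x \<bullet> b i" using x i j by (auto simp: mem_Q)
    ultimately show ?thesis unfolding in_segment using xi by (intro exI[of _ "x \<bullet> b j"]) auto
  qed
  ultimately have "closed_segment (vert i S) (vert j S) = ?F" by blast
  then show "closed_segment (vert i S) (vert j S) face_of Q" using face by simp
qed

lemma adjacent_cube_edge:
  assumes i: "i \<in> {1..n}" "S \<subseteq> {1..k}" and l: "l \<in> {1..k}" "l \<notin> S"
  shows "adjacent Q (vert i S) (vert i (insert l S))"
proof (rule segment_edge)
  have i': "insert l S \<subseteq> {1..k}" using i l by auto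
  show "vert i S \<noteq> vert i (insert l S)" using vert_inject[OF i i(1) i'] l by blast
  \<comment> \<open>The coordinate \<open>l\<close> is in neither fixed set and parametrises the
    segment.\<close>
  let ?F = "{x \<in> Q. (\<forall>p\<in>{1..n} - {i}. x \<bullet> b p = 0) \<and>
    (\<forall>m\<in>{1..k} - insert l S. x \<bullet> b (n + m) = 0) \<and> (\<forall>m\<in>S. x \<bullet> b (n + m) = 1)}"
  have face: "?F face_of Q" using i by (intro Q_face) auto
  have "closed_segment (vert i S) (vert i (insert l S)) \<subseteq> ?F"
    using i i' vert_in_Q face_of_imp_convex[OF face]
    by (intro closed_segment_subset) (auto simp: inner_vert subset_iff)
  moreover have "x \<in> closed_segment (vert i S) (vert i (insert l S))" if x: "x \<in> ?F" for x
  proof -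
    have "(\<Sum>p\<in>{1..n}. x \<bullet> b p) = x \<bullet> b i"
      using x i by (subst sum.remove[of _ i]) auto
    then have xi: "x \<bullet> b i = 1" using x by (simp add: mem_Q)
    let ?t = "x \<bullet> b (n + l)"
    have "x = (1 - ?t) *\<^sub>R vert i S + ?t *\<^sub>R vert i (insert l S)"
      by (rule eqI_b) (use x xi i i' l in \<open>auto simp: inner_vert inner_add_left\<close>)
    moreover have "0 \<le> ?t" "?t \<le> 1" using x l by (auto simp: mem_Q)
    ultimately show ?thesis unfolding in_segment by (intro exI[of _ ?t]) auto
  qed
  ultimately have "closed_segment (vert i S) (vert i (insert l S)) = ?F" by blast
  then show "closed_segment (vert i S) (vert i (insert l S)) face_of Q" using face by simp
qed

lemma improving_iff:
  assumes i: "i \<in> {1..n}" "S \<subseteq> {1..k}" and j: "j \<in> {1..n}" "T \<subseteq> {1..k}"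
  shows "adjacent Q (vert i S) (vert j T) \<and> obj \<bullet> vert i S < obj \<bullet> vert j T \<longleftrightarrow>
    (S = T \<and> i < j) \<or> (i = j \<and> (\<exists>l\<in>{1..k} - S. T = insert l S))" (is "?L \<longleftrightarrow> ?R")
proof
  assume L: ?L
  then have less: "c i + sum r S < c j + sum r T" using inner_obj_vert i j by simp
  from L adjacent_vert_cases[OF i j] consider "S = T" | l where "i = j" "sym_diff S T = {l}"
    by blast
  then show ?R
  proof cases
    case 1
    then show ?thesis using less c_less[of j i] i j by (cases i j rule: linorder_cases) auto
  next
    case 2
    have sd: "x \<in> sym_diff S T \<longleftrightarrow> x = l" for x unfolding 2(2) by simp
    have l: "l \<in> {1..k}" using sd[of l] subsetD[OF i(2), of l] subsetD[OF j(2), of l] by blast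
    have fin: "finite S" "finite T" using i j finite_subset by auto
    have "0 < r l" using r l by blast
    have "l \<notin> S"
    proof
      assume "l \<in> S"
      then have "x \<in> S \<longleftrightarrow> x \<in> insert l T" for x using sd[of x] by blast
      then have "S = insert l T" "l \<notin> T" using sd[of l] by blast+
      then show False using less fin \<open>0 < r l\<close> 2(1) by auto
    qed
    have "x \<in> T \<longleftrightarrow> x \<in> insert l S" for x using sd[of x] \<open>l \<notin> S\<close> by blast
    then have "T = insert l S" by blast
    then show ?thesis using 2(1) l \<open>l \<notin> S\<close> by blast
  qed
next
  assume ?R
  then consider "S = T" "i < j" | l where "i = j" "l \<in> {1..k}" "l \<notin> S" "T = insert l S" by blast
  then show ?L
  proof cases
    case 1
    then show ?thesis using adjacent_simplex_edge[OF i j(1)] c_less[of i j] i j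
      by (simp add: inner_obj_vert)
  next
    case 2
    have "finite S" using i finite_subset by auto
    then show ?thesis using 2 adjacent_cube_edge[OF i 2(2,3)] i j r
      by (simp add: inner_obj_vert)
  qed
qed

section \<open>Slopes of the improving edges\<close>

lemma slope_simplex_edge:
  assumes "i \<in> {1..n}" "j \<in> {1..n}" "S \<subseteq> {1..k}"
  shows "w \<bullet> (vert j S - vert i S) / (obj \<bullet> (vert j S - vert i S)) =
    (w \<bullet> b j - w \<bullet> b i) / (c j - c i)"
  using assms by (simp add: inner_diff_right inner_obj_vert) (simp add: vert_def inner_add_right)

lemma slope_cube_edge:
  assumes "i \<in> {1..n}" "S \<subseteq> {1..k}" "l \<in> {1..k}" "l \<notin> S"
  shows "w \<bullet> (vert i (insert l S) - vert i S) / (obj \<bullet> (vert i (insert l S) - vert i S)) =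
    w \<bullet> b (n + l) / r l"
proof -
  have "finite S" using assms finite_subset by auto
  then show ?thesis
    using assms by (simp add: inner_diff_right inner_obj_vert) (simp add: vert_def inner_add_right)
qed

end

section \<open>Evaluations as coherent arborescences\<close>

lemma strictly_decreasing_enumeration:
  fixes m :: "nat \<Rightarrow> real"
  assumes inj: "inj_on m {1..k}"
  obtains s where "s permutes {1..k}"
    and "\<And>t u. t \<in> {1..k} \<Longrightarrow> u \<in> {1..k} \<Longrightarrow> t < u \<Longrightarrow> m (s u) < m (s t)"
proof -
  \<comment> \<open>The rank in decreasing order, counted from 1; \<open>permutes\<close> needs the
    identity outside \<open>{1..k}\<close>.\<close>
  define pos where "pos l = (if l \<in> {1..k} then card {j \<in> {1..k}. m l \<le> m j} else l)" for l
  have less: "pos l < pos l'" if l: "l \<in> {1..k}" "l' \<in> {1..k}" "m l' < m l" for l l'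
  proof -
    have "{j \<in> {1..k}. m l \<le> m j} \<subseteq> {j \<in> {1..k}. m l' \<le> m j}"
      and "l' \<in> {j \<in> {1..k}. m l' \<le> m j} - {j \<in> {1..k}. m l \<le> m j}"
      using l by auto
    then have "{j \<in> {1..k}. m l \<le> m j} \<subset> {j \<in> {1..k}. m l' \<le> m j}" by blast
    then have "card {j \<in> {1..k}. m l \<le> m j} < card {j \<in> {1..k}. m l' \<le> m j}"
      by (intro psubset_card_mono) auto
    then show ?thesis using l by (simp add: pos_def)
  qed
  have inj_pos: "inj_on pos {1..k}"
  proof (rule inj_onI, rule ccontr)
    fix l l' assume l: "l \<in> {1..k}" "l' \<in> {1..k}" "pos l = pos l'" "l \<noteq> l'"
    then have "m l \<noteq> m l'" using inj by (auto dest: inj_onD)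
    then show False using less[of l l'] less[of l' l] l by (cases "m l < m l'") auto
  qed
  have "pos l \<in> {1..k}" if l: "l \<in> {1..k}" for l
  proof -
    have "card {l} \<le> card {j \<in> {1..k}. m l \<le> m j}" using l by (intro card_mono) auto
    moreover have "card {j \<in> {1..k}. m l \<le> m j} \<le> card {1..k}" by (intro card_mono) auto
    ultimately show ?thesis using l by (simp add: pos_def)
  qed
  then have "pos ` {1..k} = {1..k}" using inj_pos by (intro endo_inj_surj) auto
  then have pos: "pos permutes {1..k}"
    using inj_pos by (intro bij_imp_permutes) (auto simp: bij_betw_def pos_def)
  \<comment> \<open>\<open>pos\<close> sends an element to its position, whereas \<open>s\<close>
    must send positions to elements.\<close>
  define s where "s = inv_into UNIV pos"
  show thesis
  proof (rule that)
    show s: "s permutes {1..k}" unfolding s_def using permutes_inv[OF pos] .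
    fix t u assume t: "t \<in> {1..k}" "u \<in> {1..k}" "t < u"
    have in_range: "s t \<in> {1..k}" "s u \<in> {1..k}"
      using t permutes_in_image[OF s] by auto
    have pos_inv: "pos (s t) = t" "pos (s u) = u"
      unfolding s_def using permutes_inverses(1)[OF pos] by auto
    show "m (s u) < m (s t)"
    proof (rule ccontr)
      assume "\<not> ?thesis"
      moreover have "s t = s u" if "m (s t) = m (s u)" using inj that in_range by (rule inj_onD)
      ultimately have "m (s t) < m (s u) \<or> s t = s u" by linarith
      then show False using less[OF in_range(2,1)] pos_inv t by auto
    qed
  qed
qed

context simplex_cube
begin

section \<open>The arborescence of an evaluation\<close>

text \<open>A position in the order \<open>s\<close>, not a morphism label, because it is compared
  with the count \<open>phi i\<close>. It is meaningful only while some morphism is missing from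
  \<open>S\<close>.\<close>

definition first_free :: "(nat \<Rightarrow> nat) \<Rightarrow> nat set \<Rightarrow> nat" where
  "first_free s S = (LEAST t. t \<in> {1..k} \<and> s t \<notin> S)"

lemma first_free:
  assumes "s permutes {1..k}" "S \<subseteq> {1..k}" "S \<noteq> {1..k}"
  shows "first_free s S \<in> {1..k}" "s (first_free s S) \<notin> S"
    and "\<And>u. u \<in> {1..k} \<Longrightarrow> s u \<notin> S \<Longrightarrow> first_free s S \<le> u"
proof -
  obtain l where l: "l \<in> {1..k}" "l \<notin> S" using assms by blast
  then obtain t where "t \<in> {1..k}" "s t = l" using permutes_image[OF assms(1)] by (metis imageE)
  then have "t \<in> {1..k} \<and> s t \<notin> S" using l by simp
  from LeastI[of "\<lambda>t. t \<in> {1..k} \<and> s t \<notin> S", OF this]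
  show "first_free s S \<in> {1..k}" "s (first_free s S) \<notin> S" by (simp_all add: first_free_def)
  show "first_free s S \<le> u" if "u \<in> {1..k}" "s u \<notin> S" for u
    unfolding first_free_def using that by (simp add: Least_le)
qed

lemma first_free_eqI:
  assumes "t \<in> {1..k}" "s t \<notin> S" "\<And>u. u \<in> {1..k} \<Longrightarrow> u < t \<Longrightarrow> s u \<in> S"
  shows "first_free s S = t"
  unfolding first_free_def
  by (rule Least_equality) (use assms not_le_imp_less in blast)+

text \<open>The vertex \<open>(i, S)\<close> is the state in which the morphisms \<open>f l\<close>, \<open>l \<in> S\<close>, have been applied.
  The step performed there is the next morphism in the order \<open>s 1, s 2, \<dots>\<close> (the reverse of the order
  in which the composition applies them, which does not matter for counting), unless
  multiplication \<open>i\<close> is due before it.\<close>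

fun eval_step :: "(nat \<Rightarrow> nat) \<times> nat tree \<times> (nat \<Rightarrow> nat) \<Rightarrow> nat \<times> nat set \<Rightarrow> nat \<times> nat set" where
  "eval_step (s, T, phi) (i, S) =
     (if S \<noteq> {1..k} \<and> (i = n \<or> first_free s S \<le> phi i) then (i, insert (s (first_free s S)) S)
      else (succ_above T n i, S))"

fun improving :: "nat \<times> nat set \<Rightarrow> nat \<times> nat set \<Rightarrow> bool" where
  "improving (i, S) (j, T) \<longleftrightarrow> S = T \<and> i < j \<or> i = j \<and> (\<exists>l\<in>{1..k} - S. T = insert l S)"

definition slope :: "'a \<Rightarrow> 'a \<Rightarrow> 'a \<Rightarrow> real" where
  "slope w v u = w \<bullet> (u - v) / (obj \<bullet> (u - v))"

abbreviation "point \<equiv> case_prod vert"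

lemma inj_on_point: "inj_on point idx"
  by (rule inj_onI) (auto simp: vert_inject)

lemma point_adjacent_iff:
  assumes "x \<in> idx" "y \<in> idx"
  shows "adjacent Q (point x) (point y) \<and> obj \<bullet> point x < obj \<bullet> point y \<longleftrightarrow> improving x y"
  using improving_iff assms by (cases x; cases y) auto

lemma vertices_minus_opt: "vertices Q - {v_opt Q obj} = point ` (idx - {(n, {1..k})})"
proof -
  have "(n, {1..k}) \<in> idx" using n by simp
  then have "point ` (idx - {(n, {1..k})}) = point ` idx - point ` {(n, {1..k})}"
    by (intro inj_on_image_set_diff[OF inj_on_point]) auto
  then show ?thesis by (simp add: vertices_Q v_opt_Q)
qed

lemma nonopt_cases:
  assumes "x \<in> idx - {(n, {1..k})}"
  obtains i S where "x = (i, S)" "i \<in> {1..n}" "S \<subseteq> {1..k}" "i = n \<longrightarrow> S \<noteq> {1..k}"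
  using assms by (cases x) fastforce

text \<open>\<open>eval_step\<close> carried from index pairs to vertices. The restriction supplies
  the default value outside the domain that \<open>arborescences\<close> prescribes.\<close>

definition arb :: "(nat \<Rightarrow> nat) \<times> nat tree \<times> (nat \<Rightarrow> nat) \<Rightarrow> 'a \<Rightarrow> 'a" where
  "arb e = restrict (\<lambda>v. point (eval_step e (the_inv_into idx point v))) (vertices Q - {v_opt Q obj})"

lemma arb_point:
  assumes "x \<in> idx - {(n, {1..k})}"
  shows "arb e (point x) = point (eval_step e x)"
  using assms vertices_minus_opt the_inv_into_f_f[OF inj_on_point, of x]
  by (auto simp: arb_def)

lemma atLeastAtMost_diff_one: "{1..n - 1} = {1..<n}"
  using n by auto

lemma evaluationsD:
  assumes "(s, T, phi) \<in> evaluations n k"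
  shows "s permutes {1..k}" "bst T" "set_tree T = {1..<n}"
    and "phi \<in> {1..<n} \<rightarrow>\<^sub>E {0..k}" "monotone_on {1..<n} (tree_le T) (\<le>) phi"
  using assms unfolding evaluations_def search_trees_def atLeastAtMost_diff_one by auto

lemma eval_step:
  assumes e: "(s, T, phi) \<in> evaluations n k" and x: "x \<in> idx - {(n, {1..k})}"
  shows "eval_step (s, T, phi) x \<in> idx" "improving x (eval_step (s, T, phi) x)"
proof -
  note D = evaluationsD[OF e]
  obtain i S where iS: "x = (i, S)" "i \<in> {1..n}" "S \<subseteq> {1..k}" "i = n \<longrightarrow> S \<noteq> {1..k}"
    using x by (rule nonopt_cases)
  have "eval_step (s, T, phi) x \<in> idx \<and> improving x (eval_step (s, T, phi) x)"
  proof (cases "S \<noteq> {1..k} \<and> (i = n \<or> first_free s S \<le> phi i)")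
    case True
    then have "s (first_free s S) \<in> {1..k} - S"
      using first_free[OF D(1) iS(3)] permutes_in_image[OF D(1)] by auto
    then show ?thesis using True iS by auto
  next
    case False
    then have "i \<in> {1..<n}" using iS by auto
    then show ?thesis using False iS succ_above_bounds[OF D(2,3), of i] by auto
  qed
  then show "eval_step (s, T, phi) x \<in> idx" "improving x (eval_step (s, T, phi) x)" by auto
qed

section \<open>Functionals realizing an evaluation\<close>

text \<open>Link between functionals and evaluations: \<open>realizable\<close> builds such a
  \<open>w\<close>, \<open>coherent_realizes\<close> reads the data off a given one. Both branches
  being strict, no cube slope ties with a simplex slope \<open>M i\<close>.\<close>

definition realizes :: "'a \<Rightarrow> (nat \<Rightarrow> nat) \<Rightarrow> nat tree \<Rightarrow> (nat \<Rightarrow> nat) \<Rightarrow> (nat \<Rightarrow> real) \<Rightarrow> bool" where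
  "realizes w s T phi M \<longleftrightarrow> steepest n c (\<lambda>i. w \<bullet> b i) (succ_above T n) M \<and>
     (\<forall>t\<in>{1..k}. \<forall>u\<in>{1..k}. t < u \<longrightarrow> w \<bullet> b (n + s u) / r (s u) < w \<bullet> b (n + s t) / r (s t)) \<and>
     (\<forall>i\<in>{1..<n}. \<forall>t\<in>{1..k}. if t \<le> phi i then M i < w \<bullet> b (n + s t) / r (s t)
        else w \<bullet> b (n + s t) / r (s t) < M i)"

lemma slope_simplex:
  assumes "steepest n c (\<lambda>i. w \<bullet> b i) A M" "i \<in> {1..<n}" "i < j" "j \<le> n" "S \<subseteq> {1..k}"
  shows "slope w (vert i S) (vert j S) \<le> M i"
    and "j = A i \<Longrightarrow> slope w (vert i S) (vert j S) = M i"
    and "j \<noteq> A i \<Longrightarrow> slope w (vert i S) (vert j S) < M i"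
proof -
  have eq: "slope w (vert i S) (vert j S) = (w \<bullet> b j - w \<bullet> b i) / (c j - c i)"
    unfolding slope_def using assms by (intro slope_simplex_edge) auto
  have "0 < c j - c i" using c_less[of i j] assms by auto
  then show "slope w (vert i S) (vert j S) \<le> M i"
    and "j = A i \<Longrightarrow> slope w (vert i S) (vert j S) = M i"
    and "j \<noteq> A i \<Longrightarrow> slope w (vert i S) (vert j S) < M i"
    using steepestD[OF assms(1,2)] assms(3,4) unfolding eq by (auto simp: field_simps)
qed

lemma slope_cube:
  assumes "i \<in> {1..n}" "S \<subseteq> {1..k}" "l \<in> {1..k}" "l \<notin> S"
  shows "slope w (vert i S) (vert i (insert l S)) = w \<bullet> b (n + l) / r l"
  unfolding slope_def using assms by (rule slope_cube_edge)

text \<open>At \<open>(i, S)\<close> the best cube slope sits at the first free position and, for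
  \<open>i < n\<close>, the best simplex slope is \<open>M i\<close>. Comparing that position with
  \<open>phi i\<close> tells which is larger, as in \<open>eval_step\<close>.\<close>

lemma realizes_steepest:
  assumes e: "(s, T, phi) \<in> evaluations n k" and w: "realizes w s T phi M"
    and x: "x \<in> idx - {(n, {1..k})}" and y: "y \<in> idx" "improving x y" "y \<noteq> eval_step (s, T, phi) x"
  shows "slope w (point x) (point y) < slope w (point x) (point (eval_step (s, T, phi) x))"
proof -
  note D = evaluationsD[OF e]
  let ?m = "\<lambda>l. w \<bullet> b (n + l) / r l"
  have st: "steepest n c (\<lambda>i. w \<bullet> b i) (succ_above T n) M"
    and decr: "\<And>t u. t \<in> {1..k} \<Longrightarrow> u \<in> {1..k} \<Longrightarrow> t < u \<Longrightarrow> ?m (s u) < ?m (s t)"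
    and before: "\<And>i t. i \<in> {1..<n} \<Longrightarrow> t \<in> {1..k} \<Longrightarrow> t \<le> phi i \<Longrightarrow> M i < ?m (s t)"
    and after: "\<And>i t. i \<in> {1..<n} \<Longrightarrow> t \<in> {1..k} \<Longrightarrow> \<not> t \<le> phi i \<Longrightarrow> ?m (s t) < M i"
    using w unfolding realizes_def by (auto split: if_splits)
  obtain i S where iS: "x = (i, S)" "i \<in> {1..n}" "S \<subseteq> {1..k}" "i = n \<longrightarrow> S \<noteq> {1..k}"
    using x by (rule nonopt_cases)
  obtain j U where jU: "y = (j, U)" "j \<in> {1..n}" "U \<subseteq> {1..k}" using y(1) by auto
  consider "U = S" "i < j" | l where "j = i" "l \<in> {1..k}" "l \<notin> S" "U = insert l S"
    using y(2) iS(1) jU(1) by auto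
  then show ?thesis
  proof cases
    case 1
    then have i: "i \<in> {1..<n}" using iS jU by auto
    note sl = slope_simplex[OF st i 1(2) _ iS(3)]
    show ?thesis
    proof (cases "S \<noteq> {1..k} \<and> first_free s S \<le> phi i")
      case True
      note ff = first_free[OF D(1) iS(3)]
      have "s (first_free s S) \<in> {1..k}" using ff True permutes_in_image[OF D(1)] by auto
      then have "slope w (point x) (point (eval_step (s, T, phi) x)) = ?m (s (first_free s S))"
        using True iS slope_cube[OF iS(2,3)] ff(2) by auto
      moreover have "M i < ?m (s (first_free s S))" using before[OF i] ff(1) True by auto
      ultimately show ?thesis using sl(1) iS jU 1 by auto
    next
      case False
      then have eval: "eval_step (s, T, phi) x = (succ_above T n i, S)" using iS i by auto
      then have "slope w (point x) (point y) < M i" using sl(3) iS jU 1 y(3) by auto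
      moreover have "slope w (vert i S) (vert (succ_above T n i) S) = M i"
        using slope_simplex(2)[OF st i _ _ iS(3)] steepestD(1,2)[OF st i] by auto
      ultimately show ?thesis using eval iS by simp
    qed
  next
    case (2 l)
    have "S \<noteq> {1..k}" using 2 by auto
    note ff = first_free[OF D(1) iS(3) this]
    have ff': "s (first_free s S) \<in> {1..k}" using ff permutes_in_image[OF D(1)] by auto
    obtain u where u: "u \<in> {1..k}" "l = s u"
      using 2(2) permutes_image[OF D(1)] by (metis imageE)
    have "first_free s S \<le> u" using ff(3) u 2 by simp
    have sl: "slope w (point x) (point y) = ?m (s u)"
      using slope_cube[OF iS(2,3) 2(2,3)] iS jU 2 u by simp
    show ?thesis
    proof (cases "i = n \<or> first_free s S \<le> phi i")
      case True
      then have eval: "eval_step (s, T, phi) x = (i, insert (s (first_free s S)) S)"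
        using iS \<open>S \<noteq> {1..k}\<close> by simp
      then have "u \<noteq> first_free s S" using y(3) jU 2 u by auto
      then have "?m (s u) < ?m (s (first_free s S))"
        using decr[OF ff(1) u(1)] \<open>first_free s S \<le> u\<close> by simp
      then show ?thesis unfolding sl eval using slope_cube[OF iS(2,3) ff' ff(2)] iS by simp
    next
      case False
      then have i: "i \<in> {1..<n}" using iS by auto
      have eval: "eval_step (s, T, phi) x = (succ_above T n i, S)" using False iS by auto
      have "slope w (vert i S) (vert (succ_above T n i) S) = M i"
        using slope_simplex(2)[OF st i _ _ iS(3)] steepestD(1,2)[OF st i] by auto
      moreover have "?m (s u) < M i" using after[OF i u(1)] False \<open>first_free s S \<le> u\<close> by auto
      ultimately show ?thesis unfolding sl eval using iS by simp
    qed
  qed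
qed

lemma realizes_coherent:
  assumes e: "(s, T, phi) \<in> evaluations n k" and w: "realizes w s T phi M"
  shows "coherent Q obj w (arb (s, T, phi))"
proof -
  have A: "arb (s, T, phi) (point x) \<in> vertices Q \<and> adjacent Q (point x) (arb (s, T, phi) (point x)) \<and>
      obj \<bullet> point x < obj \<bullet> arb (s, T, phi) (point x)"
    if x: "x \<in> idx - {(n, {1..k})}" for x
    unfolding arb_point[OF x] vertices_Q
    using eval_step[OF e x] point_adjacent_iff[OF DiffD1[OF x] eval_step(1)[OF e x]]
    by (intro conjI imageI) simp_all
  have "arb (s, T, phi) \<in> arborescences Q obj"
    unfolding arborescences_def vertices_minus_opt
    using A by (auto simp: arb_def vertices_minus_opt simp del: eval_step.simps)
  moreover have "w \<bullet> (u - v) / (obj \<bullet> (u - v)) <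
      w \<bullet> (arb (s, T, phi) v - v) / (obj \<bullet> (arb (s, T, phi) v - v))"
    if v: "v \<in> vertices Q - {v_opt Q obj}" and u: "u \<in> vertices Q" "adjacent Q v u" "obj \<bullet> v < obj \<bullet> u"
      "u \<noteq> arb (s, T, phi) v" for v u
  proof -
    obtain x where x: "x \<in> idx - {(n, {1..k})}" "v = point x" using v vertices_minus_opt by blast
    obtain y where y: "y \<in> idx" "u = point y" using u vertices_Q by blast
    have "improving x y" using point_adjacent_iff[of x y] x y u by blast
    moreover have "y \<noteq> eval_step (s, T, phi) x" using arb_point[OF x(1)] x y u by metis
    ultimately show ?thesis
      using realizes_steepest[OF e w x(1) y(1)] arb_point[OF x(1)] x(2) y(2) unfolding slope_def by simp
  qed
  ultimately show ?thesis unfolding coherent_def by blast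
qed

text \<open>The cube slope at position \<open>t\<close> is put at \<open>- t\<close>. Then
  \<open>M i\<close> is placed strictly between the slopes of positions \<open>phi i\<close> and
  \<open>phi i + 1\<close>, and \<open>h\<close> orders the slopes inside one such gap along the
  tree.\<close>

lemma realizable:
  assumes e: "(s, T, phi) \<in> evaluations n k"
  shows "\<exists>w M. realizes w s T phi M"
proof -
  note D = evaluationsD[OF e]
  let ?A = "succ_above T n"
  note A = succ_above_bounds[OF D(2,3)]
  have mono: "\<forall>i \<in> {1..<n}. (\<forall>p. i < p \<and> p < ?A i \<longrightarrow> phi p \<le> phi i) \<and>
      (?A i < n \<longrightarrow> phi i \<le> phi (?A i))"
    using D(5) monotone_on_tree_le_iff[OF D(2,3)] by blast
  \<comment> \<open>\<open>h\<close> is a linear extension of the tree order with values in \<open>{0<..<1}\<close>.\<close>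
  define h where "h i = (real n * real (?A i) - real i) / (real n * real n)" for i
  define M where "M i = - real (phi i) - h i" for i
  have n0: "0 < real n * real n" using n by simp
  have h: "0 < h i" "h i < 1" if "i \<in> {1..<n}" for i
  proof -
    have "real i < real n * 1" using that by simp
    also have "\<dots> \<le> real n * real (?A i)" using A[OF that] that by (intro mult_left_mono) auto
    finally show "0 < h i" using n0 by (simp add: h_def)
    have "real n * real (?A i) \<le> real n * real n" using A[OF that] by (intro mult_left_mono) auto
    moreover have "0 < real i" using that by simp
    ultimately have "real n * real (?A i) - real i < real n * real n" by linarith
    then show "h i < 1" using n0 by (simp add: h_def)
  qed
  \<comment> \<open>The numerator grows with the target and, at equal targets, with decreasing
    index.\<close>
  have h_mono: "h p < h q" if "real n * real (?A p) - real p < real n * real (?A q) - real q" for p q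
    unfolding h_def using that n0 by (rule divide_strict_right_mono)
  have inside: "M i < M p" if i: "i \<in> {1..<n}" "i < p" "p < ?A i" for i p
  proof -
    have "?A p \<le> ?A i" using succ_above_noncrossing[OF D(2,3) i] .
    then have "real n * real (?A p) \<le> real n * real (?A i)" by (intro mult_left_mono) auto
    then have "h p < h i" using i(2) by (intro h_mono) linarith
    then show ?thesis using mono i by (force simp: M_def)
  qed
  have at_target: "M (?A i) < M i" if i: "i \<in> {1..<n}" "?A i < n" for i
  proof -
    have "?A i \<in> {1..<n}" using i A(1)[OF i(1)] by auto
    then have "real n * (real (?A i) + 1) \<le> real n * real (?A (?A i))"
      using A(1)[of "?A i"] by (intro mult_left_mono) auto
    then have "h i < h (?A i)" using i by (intro h_mono) (auto simp: algebra_simps)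
    then show ?thesis using mono i by (force simp: M_def)
  qed
  obtain W where W: "steepest n c W ?A M"
    using steepest_exists[OF c, of ?A M] A succ_above_noncrossing[OF D(2,3)] inside at_target by blast
  \<comment> \<open>The inverse of \<open>s\<close> gives the position of \<open>l\<close>; the
    factor \<open>r l\<close> cancels in the slope.\<close>
  define w where "w = (\<Sum>p\<in>{1..n}. W p *\<^sub>R b p) + (\<Sum>l\<in>{1..k}. (- real (inv_into UNIV s l) * r l) *\<^sub>R b (n + l))"
  have wb: "w \<bullet> b p = W p" if "p \<in> {1..n}" for p
    unfolding w_def inner_add_left using that
    by (subst inner_sum_b, simp, simp, subst inner_sum_b_cube(1)) auto
  have slope_s: "w \<bullet> b (n + s t) / r (s t) = - real t" if "t \<in> {1..k}" for t
  proof -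
    have st: "s t \<in> {1..k}" using that permutes_in_image[OF D(1)] by auto
    then have "w \<bullet> b (n + s t) = - real (inv_into UNIV s (s t)) * r (s t)"
      unfolding w_def inner_add_left
      by (subst inner_sum_b, simp, simp, subst inner_sum_b_cube(2)) auto
    moreover have "r (s t) \<noteq> 0" using r st by force
    ultimately show ?thesis using permutes_inverses(2)[OF D(1)] by simp
  qed
  have "steepest n c (\<lambda>i. w \<bullet> b i) ?A M"
    unfolding steepest_def
  proof (intro ballI conjI impI)
    fix i assume i: "i \<in> {1..<n}"
    note st = steepestD[OF W i]
    show "?A i \<in> {i<..n}" using st by simp
    show "w \<bullet> b (?A i) - w \<bullet> b i = M i * (c (?A i) - c i)" using st(1,2,3) i by (simp add: wb)
    show "w \<bullet> b q - w \<bullet> b i < M i * (c q - c i)" if "q \<in> {i<..n}" "q \<noteq> ?A i" for q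
      using st(4)[of q] that i by (simp add: wb)
  qed
  moreover have "if t \<le> phi i then M i < w \<bullet> b (n + s t) / r (s t) else w \<bullet> b (n + s t) / r (s t) < M i"
    if i: "i \<in> {1..<n}" and t: "t \<in> {1..k}" for i t
    using h[OF i] unfolding slope_s[OF t] M_def by auto
  moreover have "w \<bullet> b (n + s u) / r (s u) < w \<bullet> b (n + s t) / r (s t)"
    if "t \<in> {1..k}" "u \<in> {1..k}" "t < u" for t u
    using that by (simp add: slope_s)
  ultimately have "realizes w s T phi M" unfolding realizes_def by blast
  then show ?thesis by blast
qed

section \<open>Reading an evaluation off a functional\<close>

lemma coherentE:
  assumes B: "coherent Q obj w B" and x: "x \<in> idx - {(n, {1..k})}"
  obtains y where "y \<in> idx" "improving x y"
    and "\<And>z. z \<in> idx \<Longrightarrow> improving x z \<Longrightarrow> z \<noteq> y \<Longrightarrow>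
      slope w (point x) (point z) < slope w (point x) (point y)"
proof -
  have v: "point x \<in> vertices Q - {v_opt Q obj}" using x vertices_minus_opt by blast
  then have Bx: "B (point x) \<in> vertices Q" "adjacent Q (point x) (B (point x))"
      "obj \<bullet> point x < obj \<bullet> B (point x)"
    using B unfolding coherent_def arborescences_def by blast+
  from Bx(1) obtain y where y: "y \<in> idx" "B (point x) = point y"
    unfolding vertices_Q by (rule imageE)
  have imp: "improving x y" using Bx(2,3) point_adjacent_iff[OF DiffD1[OF x] y(1)] y(2) by simp
  show thesis
  proof (rule that[OF y(1) imp])
    fix z assume z: "z \<in> idx" "improving x z" "z \<noteq> y"
    have "point z \<noteq> point y" using inj_onD[OF inj_on_point _ z(1) y(1)] z(3) by blast
    moreover have "adjacent Q (point x) (point z) \<and> obj \<bullet> point x < obj \<bullet> point z"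
      using point_adjacent_iff[of x z] x z by blast
    moreover have "point z \<in> vertices Q" using z vertices_Q by blast
    ultimately show "slope w (point x) (point z) < slope w (point x) (point y)"
      using B v unfolding coherent_def slope_def y(2)[symmetric] by blast
  qed
qed

text \<open>Suitable vertices isolate each comparison: \<open>S = {1..k}\<close> leaves only simplex
  edges and yields \<open>A\<close> and \<open>M\<close>; omitting two labels at
  \<open>i = n\<close> shows that cube slopes are distinct; omitting one label shows that its slope
  differs from \<open>M i\<close>.\<close>

lemma coherent_realizes:
  assumes B: "coherent Q obj w B"
  shows "\<exists>s T phi M. (s, T, phi) \<in> evaluations n k \<and> realizes w s T phi M"
proof -
  let ?W = "\<lambda>i. w \<bullet> b i" and ?m = "\<lambda>l. w \<bullet> b (n + l) / r l"
  have "\<exists>j\<in>{i<..n}. \<forall>q\<in>{i<..n}. q \<noteq> j \<longrightarrow> (?W q - ?W i) / (c q - c i) < (?W j - ?W i) / (c j - c i)"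
    if i: "i \<in> {1..<n}" for i
  proof -
    have "(i, {1..k}) \<in> idx - {(n, {1..k})}" using i by auto
    from coherentE[OF B this] obtain y where y: "y \<in> idx" "improving (i, {1..k}) y"
      "\<And>z. z \<in> idx \<Longrightarrow> improving (i, {1..k}) z \<Longrightarrow> z \<noteq> y \<Longrightarrow>
        slope w (point (i, {1..k})) (point z) < slope w (point (i, {1..k})) (point y)" by metis
    then obtain j where j: "y = (j, {1..k})" "j \<in> {i<..n}" by (cases y) auto
    have "slope w (vert i {1..k}) (vert q {1..k}) = (?W q - ?W i) / (c q - c i)" if "q \<in> {i<..n}" for q
      unfolding slope_def using that i by (intro slope_simplex_edge) auto
    then show ?thesis using y(3)[of "(_, {1..k})"] j i by (intro bexI[of _ j]) auto
  qed
  then obtain A where A: "\<And>i. i \<in> {1..<n} \<Longrightarrow> A i \<in> {i<..n}"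
    and max: "\<And>i q. i \<in> {1..<n} \<Longrightarrow> q \<in> {i<..n} \<Longrightarrow> q \<noteq> A i \<Longrightarrow>
      (?W q - ?W i) / (c q - c i) < (?W (A i) - ?W i) / (c (A i) - c i)"
    by metis
  define M where "M i = (?W (A i) - ?W i) / (c (A i) - c i)" for i
  have st: "steepest n c ?W A M"
    unfolding steepest_def
  proof (intro ballI conjI impI)
    fix i assume i: "i \<in> {1..<n}"
    show "A i \<in> {i<..n}" using A[OF i] .
    have pos: "0 < c q - c i" if "q \<in> {i<..n}" for q using c_less[of i q] that i by auto
    show "?W (A i) - ?W i = M i * (c (A i) - c i)" using pos[OF A[OF i]] by (simp add: M_def)
    show "?W q - ?W i < M i * (c q - c i)" if "q \<in> {i<..n}" "q \<noteq> A i" for q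
      using max[OF i that] pos[OF that(1)] by (simp add: M_def pos_divide_less_eq)
  qed
  have "inj_on ?m {1..k}"
  proof (rule inj_onI, rule ccontr)
    fix l l' assume l: "l \<in> {1..k}" "l' \<in> {1..k}" "?m l = ?m l'" "l \<noteq> l'"
    define S where "S = {1..k} - {l, l'}"
    have S: "S \<subseteq> {1..k}" "l \<notin> S" "l' \<notin> S" by (auto simp: S_def)
    have top: "n \<in> {1..n}" using n by simp
    have "(n, S) \<in> idx - {(n, {1..k})}" using top S(1,2) l(1) by blast
    from coherentE[OF B this] obtain y where y: "y \<in> idx" "improving (n, S) y"
      "\<And>z. z \<in> idx \<Longrightarrow> improving (n, S) z \<Longrightarrow> z \<noteq> y \<Longrightarrow>
        slope w (point (n, S)) (point z) < slope w (point (n, S)) (point y)" by metis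
    have "y = (n, insert l S) \<or> y = (n, insert l' S)" using y(1,2) by (cases y) (auto simp: S_def)
    moreover have neq: "insert l S \<noteq> insert l' S" using S l by blast
    moreover have z: "(n, insert l S) \<in> idx" "improving (n, S) (n, insert l S)"
      "(n, insert l' S) \<in> idx" "improving (n, S) (n, insert l' S)" using l S top by auto
    have eq: "slope w (point (n, S)) (point (n, insert l S)) = slope w (point (n, S)) (point (n, insert l' S))"
      using slope_cube[OF top S(1) l(1) S(2), of w] slope_cube[OF top S(1) l(2) S(3), of w] l(3) by simp
    ultimately show False
    proof (elim disjE)
      assume "y = (n, insert l S)"
      then show False using y(3)[OF z(3,4)] neq eq by simp
    next
      assume "y = (n, insert l' S)"
      then show False using y(3)[OF z(1,2)] neq eq by simp
    qed
  qed
  then obtain s where s: "s permutes {1..k}"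
    and decr: "\<And>t u. t \<in> {1..k} \<Longrightarrow> u \<in> {1..k} \<Longrightarrow> t < u \<Longrightarrow> ?m (s u) < ?m (s t)"
    using strictly_decreasing_enumeration by blast
  have m_neq: "?m l \<noteq> M i" if l: "l \<in> {1..k}" and i: "i \<in> {1..<n}" for l i
  proof
    assume eq: "?m l = M i"
    define S where "S = {1..k} - {l}"
    have S: "S \<subseteq> {1..k}" "l \<notin> S" by (auto simp: S_def)
    have i': "i \<in> {1..n}" using i by auto
    have x: "(i, S) \<in> idx - {(n, {1..k})}" using i S by auto
    from coherentE[OF B this] obtain y where y: "y \<in> idx" "improving (i, S) y"
      "\<And>z. z \<in> idx \<Longrightarrow> improving (i, S) z \<Longrightarrow> z \<noteq> y \<Longrightarrow>
        slope w (point (i, S)) (point z) < slope w (point (i, S)) (point y)" by metis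
    have cube: "(i, insert l S) \<in> idx" "improving (i, S) (i, insert l S)"
      "slope w (point (i, S)) (point (i, insert l S)) = M i"
      using l i' S slope_cube[OF i' S(1) l S(2), of w] eq by auto
    have simplex: "(A i, S) \<in> idx" "improving (i, S) (A i, S)"
      "slope w (point (i, S)) (point (A i, S)) = M i"
      using A[OF i] i S slope_simplex(2)[OF st i _ _ S(1), of "A i"] by auto
    have "y = (i, insert l S) \<or> (\<exists>j. i < j \<and> j \<le> n \<and> y = (j, S))"
      using y(1,2) by (cases y) (auto simp: S_def)
    then have "slope w (point (i, S)) (point y) \<le> M i"
      using cube(3) slope_simplex(1)[OF st i _ _ S(1)] by auto
    \<comment> \<open>The steepest neighbour \<open>y\<close> has slope at most \<open>M i\<close>,
      yet one of two neighbours of slope \<open>M i\<close> differs from it and would have to be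
      strictly flatter.\<close>
    moreover have "(i, insert l S) \<noteq> y \<or> (A i, S) \<noteq> y" using A[OF i] by auto
    ultimately show False using y(3)[OF cube(1,2)] y(3)[OF simplex(1,2)] cube(3) simplex(3) by auto
  qed
  define steeper where "steeper i = {t \<in> {1..k}. M i < ?m (s t)}" for i
  define phi where "phi = restrict (\<lambda>i. card (steeper i)) {1..<n}"
  have fin: "finite (steeper i)" for i by (simp add: steeper_def)
  \<comment> \<open>Slopes decrease along \<open>s\<close>, so the positions steeper than
    \<open>M i\<close> form an initial segment of \<open>{1..k}\<close>, determined by its
    size.\<close>
  have phi_iff: "t \<le> phi i \<longleftrightarrow> M i < ?m (s t)" if i: "i \<in> {1..<n}" and t: "t \<in> {1..k}" for i t
  proof
    assume less: "M i < ?m (s t)"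
    have "{1..t} \<subseteq> steeper i"
    proof
      fix u assume "u \<in> {1..t}"
      then show "u \<in> steeper i" using decr[of u t] less t by (cases "u = t") (auto simp: steeper_def)
    qed
    then have "card {1..t} \<le> card (steeper i)" using fin by (rule card_mono[rotated])
    then show "t \<le> phi i" using i by (simp add: phi_def)
  next
    assume le: "t \<le> phi i"
    show "M i < ?m (s t)"
    proof (rule ccontr)
      assume nless: "\<not> ?thesis"
      have "steeper i \<subseteq> {1..<t}"
      proof
        fix u assume u: "u \<in> steeper i"
        then show "u \<in> {1..<t}"
          using decr[of t u] nless t by (cases u t rule: linorder_cases) (auto simp: steeper_def)
      qed
      then have "card (steeper i) \<le> card {1..<t}" by (intro card_mono) auto
      moreover have "t \<le> card (steeper i)" "1 \<le> t" using le i t by (auto simp: phi_def)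
      ultimately show False unfolding card_atLeastLessThan by linarith
    qed
  qed
  have "\<exists>T. bst T \<and> set_tree T = {1..<n} \<and> (\<forall>j\<in>{1..<n}. succ_above T n j = A j)"
    using A steepest_noncrossing[OF c st] by (intro noncrossing_imp_bst) auto
  then obtain T where T: "bst T" "set_tree T = {1..<n}" "\<And>j. j \<in> {1..<n} \<Longrightarrow> succ_above T n j = A j"
    by blast
  \<comment> \<open>A larger \<open>M\<close> is exceeded by fewer cube slopes; this turns
    decreasing slopes into increasing \<open>phi\<close>.\<close>
  have steeper_mono: "phi p \<le> phi i" if "p \<in> {1..<n}" "i \<in> {1..<n}" "M i < M p" for i p
  proof -
    have "steeper p \<subseteq> steeper i" using that(3) by (auto simp: steeper_def)
    then have "card (steeper p) \<le> card (steeper i)" using fin by (rule card_mono[rotated])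
    then show ?thesis using that by (simp add: phi_def)
  qed
  have "monotone_on {1..<n} (tree_le T) (\<le>) phi"
    unfolding monotone_on_tree_le_iff[OF T(1,2)]
  proof (intro ballI conjI allI impI)
    fix i assume i: "i \<in> {1..<n}"
    show "phi p \<le> phi i" if "i < p \<and> p < succ_above T n i" for p
      using steeper_mono[of p i] steepest_slope_inside[OF c st i, of p] that T(3)[OF i] A[OF i] i by auto
    show "phi i \<le> phi (succ_above T n i)" if "succ_above T n i < n"
      using steeper_mono[of i "A i"] steepest_slope_next[OF c st i] that T(3)[OF i] A[OF i] i by auto
  qed
  moreover have "phi \<in> {1..<n} \<rightarrow>\<^sub>E {0..k}"
  proof -
    have "card (steeper i) \<le> card {1..k}" for i by (intro card_mono) (auto simp: steeper_def)
    then show ?thesis by (auto simp: phi_def)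
  qed
  ultimately have "(s, T, phi) \<in> evaluations n k"
    unfolding evaluations_def search_trees_def atLeastAtMost_diff_one using s T by auto
  moreover have "realizes w s T phi M"
  proof -
    have "steepest n c ?W (succ_above T n) M"
      using st T(3) unfolding steepest_def by auto
    moreover have "if t \<le> phi i then M i < ?m (s t) else ?m (s t) < M i"
      if "i \<in> {1..<n}" "t \<in> {1..k}" for i t
      using phi_iff[OF that] m_neq[of "s t" i] that permutes_in_image[OF s, of t] by auto
    ultimately show ?thesis unfolding realizes_def using decr by blast
  qed
  ultimately show ?thesis by blast
qed

text \<open>The tree is recovered at \<open>S = {1..k}\<close>, the permutation at
  \<open>i = n\<close>, and \<open>phi i\<close> at the sets missing one label.\<close>

lemma inj_on_arb: "inj_on arb (evaluations n k)"
proof (rule inj_onI)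
  fix e e' assume e: "e \<in> evaluations n k" and e': "e' \<in> evaluations n k" and eq: "arb e = arb e'"
  obtain s T phi s' T' phi' where es: "e = (s, T, phi)" "e' = (s', T', phi')"
    by (cases e, cases e') auto
  note D = evaluationsD[OF e[unfolded es]] and D' = evaluationsD[OF e'[unfolded es]]
  have step: "eval_step (s, T, phi) x = eval_step (s', T', phi') x" if "x \<in> idx - {(n, {1..k})}" for x
    using eval_step(1)[OF e[unfolded es] that] eval_step(1)[OF e'[unfolded es] that]
      arb_point[OF that, of e] arb_point[OF that, of e'] eq inj_on_point unfolding es
    by (metis inj_onD)
  have "T = T'"
  proof (rule succ_above_inj[OF D(2) D'(2) D(3) D'(3)])
    fix j assume "j \<in> {1..<n}"
    then show "succ_above T n j = succ_above T' n j" using step[of "(j, {1..k})"] by auto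
  qed
  have s_eq: "s t = s' t" if "t \<in> {1..k}" for t
    using that
  proof (induction t rule: less_induct)
    case (less t)
    \<comment> \<open>With the first \<open>t - 1\<close> morphisms applied, the step at
      \<open>(n, S)\<close> adds \<open>s t\<close>; by induction \<open>S\<close> is the same for
      \<open>s'\<close>.\<close>
    define S where "S = s ` {1..<t}"
    have S': "S = s' ` {1..<t}" unfolding S_def using less by (intro image_cong) auto
    have "S \<subseteq> {1..k}" using less.prems permutes_in_image[OF D(1)] by (auto simp: S_def)
    have notin: "s t \<notin> S" "s' t \<notin> S"
      unfolding S_def by (simp add: inj_image_mem_iff[OF permutes_inj[OF D(1)]])
        (simp add: S'[unfolded S_def] inj_image_mem_iff[OF permutes_inj[OF D'(1)]])
    have "first_free s S = t" "first_free s' S = t"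
      using less.prems notin by (auto intro!: first_free_eqI simp: S_def) (auto simp: S_def[symmetric] S')
    moreover have "S \<noteq> {1..k}" using notin less.prems permutes_in_image[OF D(1)] by auto
    ultimately have "insert (s t) S = insert (s' t) S"
      using step[of "(n, S)"] \<open>S \<subseteq> {1..k}\<close> n by auto
    then show ?case using notin by blast
  qed
  have "s = s'"
  proof
    fix t show "s t = s' t"
      using s_eq[of t] permutes_not_in[OF D(1), of t] permutes_not_in[OF D'(1), of t] by fastforce
  qed
  have phi_iff: "t \<le> phi i \<longleftrightarrow> t \<le> phi' i" if i: "i \<in> {1..<n}" and t: "t \<in> {1..k}" for i t
  proof -
    \<comment> \<open>Only \<open>s t\<close> is missing, so the first free position is
      \<open>t\<close>, and the step keeps the index \<open>i\<close> exactly when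
      \<open>t \<le> phi i\<close>.\<close>
    define S where "S = {1..k} - {s t}"
    have st: "s t \<in> {1..k}" using t permutes_in_image[OF D(1)] by auto
    have "s u \<in> S" if "u \<in> {1..k}" "u < t" for u
      using that permutes_in_image[OF D(1)] permutes_inj[OF D(1)] by (auto simp: S_def dest: injD)
    then have ff: "first_free s S = t" using t by (intro first_free_eqI) (auto simp: S_def)
    have S: "S \<subseteq> {1..k}" "s t \<notin> S" by (auto simp: S_def)
    then have neq: "S \<noteq> {1..k}" using st by blast
    have eval: "eval_step (s, T, phi) (i, S) = (if t \<le> phi i then (i, insert (s t) S) else (succ_above T n i, S))"
      "eval_step (s', T', phi') (i, S) = (if t \<le> phi' i then (i, insert (s t) S) else (succ_above T' n i, S))"
      using ff neq i \<open>s = s'\<close> by simp_all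
    have "(i, S) \<in> idx - {(n, {1..k})}" using i S(1) by simp
    from step[OF this] have "fst (eval_step (s, T, phi) (i, S)) = i \<longleftrightarrow> fst (eval_step (s', T', phi') (i, S)) = i"
      by simp
    then show ?thesis
      unfolding eval using succ_above_bounds(1)[OF D(2,3) i] succ_above_bounds(1)[OF D'(2,3) i]
      by (simp split: if_splits)
  qed
  have "phi = phi'"
  proof (rule PiE_ext[OF D(4) D'(4)])
    fix i assume i: "i \<in> {1..<n}"
    have "phi i \<le> k" "phi' i \<le> k" using D(4) D'(4) i by fastforce+
    then show "phi i = phi' i"
      using phi_iff[OF i, of "phi i"] phi_iff[OF i, of "phi' i"] by fastforce
  qed
  then show "e = e'" using es \<open>s = s'\<close> \<open>T = T'\<close> by simp
qed

text \<open>For surjectivity, the evaluation read off \<open>w\<close> has an arborescence coherent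
  for the same \<open>w\<close>, so \<open>coherent_unique\<close> identifies it with
  \<open>A\<close>.\<close>

lemma bij_betw_arb: "bij_betw arb (evaluations n k) {A. \<exists>w. coherent Q obj w A}"
  unfolding bij_betw_def
proof
  show "arb ` evaluations n k = {A. \<exists>w. coherent Q obj w A}"
  proof (intro equalityI subsetI)
    fix A assume "A \<in> arb ` evaluations n k"
    then obtain s T phi where e: "(s, T, phi) \<in> evaluations n k" and A: "A = arb (s, T, phi)" by auto
    show "A \<in> {A. \<exists>w. coherent Q obj w A}"
      using realizable[OF e] realizes_coherent[OF e] unfolding A by blast
  next
    fix A assume "A \<in> {A. \<exists>w. coherent Q obj w A}"
    then obtain w where w: "coherent Q obj w A" by blast
    obtain s T phi M where e: "(s, T, phi) \<in> evaluations n k" "realizes w s T phi M"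
      using coherent_realizes[OF w] by blast
    have "A = arb (s, T, phi)"
      using coherent_unique[OF finite_vertices_Q w realizes_coherent[OF e]] .
    then show "A \<in> arb ` evaluations n k" using e(1) by blast
  qed
qed (fact inj_on_arb)

end

theorem theorem6p2:
  fixes n k :: nat
    and b :: "nat \<Rightarrow> 'a::euclidean_space"
    and c r :: "nat \<Rightarrow> real"
    and M :: "'m monoid"
    and f :: "nat \<Rightarrow> 'm \<Rightarrow> 'm"
  assumes "n \<ge> 1"
    and "bij_betw b {1..n + k} Basis"
    and "nonassoc_monoid M"
    and "\<forall>i\<in>{1..k}. monoid_morphism M (f i)"
    and "strict_mono_on {1..n} c"
    and "\<forall>j\<in>{1..k}. r j > 0"
  shows "\<exists>\<beta>. bij_betw \<beta>
           (vertices (max_slope_polytope (simplex_times_cube b n k) (objective b n k c r)))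
           (evaluations n k)"
proof -
  interpret simplex_cube n k b c r
    using assms by unfold_locales auto
  have "bij_betw (psi Q obj \<circ> arb) (evaluations n k) (vertices (max_slope_polytope Q obj))"
    using bij_betw_trans[OF bij_betw_arb bij_betw_psi[OF finite_vertices_Q]] .
  then show ?thesis
    using bij_betw_inv_into by blast
qed

end
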